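(* Let $\boldsymbol{x}=(x_1,\dots,x_M)\in\mathbb{R}^M$ with $x_1<\cdots<x_M$ and $\boldsymbol{y}_0\in\mathbb{R}^M$ with $M\ge4$. Then $$\bigcup_{f_{\mathrm{opt}}\in\mathcal{V}_0}\mathcal{G}(f_{\mathrm{opt}})=\mathcal{G}(f_{\mathrm{cano}})\cup\Big(\bigcup_{m\in\mathcal{X}}\Delta_m\Big).$$
   Context: $\mathcal{M}(\mathbb{R})$ is the space of bounded (finite, signed) Radon measures on $\mathbb{R}$ with total-variation norm $\|\cdot\|_{\mathcal{M}}$. $\mathrm{BV}^{(2)}(\mathbb{R})=\{f\in\mathcal{S}'(\mathbb{R}):\mathrm{D}^2f\in\mathcal{M}(\mathbb{R})\}$, where $\mathrm{D}^2$ is the distributional second derivative; its elements are continuous functions. Write $(t)_+=\max(0,t)$. $\mathcal{V}_0$ is the set of solutions (minimizers) of the problem (gBPC): minimize $\|\mathrm{D}^2f\|_{\mathcal{M}}$ over all $f\in\mathrm{BV}^{(2)}(\mathbb{R})$ with $f(x_m)=y_{0,m}$ for $m=1,\dots,M$. $\mathcal{G}(f)=\{(x,f(x)):x\in\mathbb{R}\}\subset\mathbb{R}^2$ is the graph of $f$. $f_{\mathrm{cano}}(x)=a_1x+a_M+\sum_{m=2}^{M-1}a_m(x-x_m)_+$ is the piecewise-linear function interpolating the data $(x_m,y_{0,m})$ with knots contained in $\{x_2,\dots,x_{M-1}\}$; here $a_1=\frac{y_{0,2}-y_{0,1}}{x_2-x_1}$, $a_m=\frac{y_{0,m+1}-y_{0,m}}{x_{m+1}-x_m}-\frac{y_{0,m}-y_{0,m-1}}{x_m-x_{m-1}}$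 for $2\le m\le M-1$, $a_M=y_{0,1}-a_1x_1$. $\mathcal{X}=\{m\in\{2,\dots,M-2\}:a_ma_{m+1}>0\}$. With $\mathrm{P}_{0,m}=(x_m,y_{0,m})$, for $m\in\mathcal{X}$ the lines $(\mathrm{P}_{0,m-1},\mathrm{P}_{0,m})$ and $(\mathrm{P}_{0,m+1},\mathrm{P}_{0,m+2})$ intersect in a single point $\widetilde{\mathrm{P}}_m=(\tilde\tau_m,\tilde y_m)$, with $x_m\le\tilde\tau_m\le x_{m+1}$, and $\Delta_m\subset\mathbb{R}^2$ is the (closed, filled) triangle with vertices $\mathrm{P}_{0,m}$, $\widetilde{\mathrm{P}}_m$, $\mathrm{P}_{0,m+1}$. *)

theory Defs
  imports "HOL-Analysis.Analysis"
begin

section \<open>Finite signed Radon measures on the real line\<close>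

text \<open>
  Finite signed Borel measures are real-valued, countably additive set functions; on the real line
  every such measure is Radon.  The value on non-Borel sets is fixed to be \<open>0\<close>, so that equality
  of measures is equality of functions.
\<close>

definition signed_measure :: "(real set \<Rightarrow> real) \<Rightarrow> bool" where
  "signed_measure \<mu> \<longleftrightarrow>
     \<mu> {} = 0 \<and>
     (\<forall>A::nat \<Rightarrow> real set. range A \<subseteq> sets borel \<and> disjoint_family A \<longrightarrow>
        (\<lambda>n. \<mu> (A n)) sums \<mu> (\<Union>n. A n)) \<and>
     (\<forall>A. A \<notin> sets borel \<longrightarrow> \<mu> A = 0)"

text \<open>
  Jordan decomposition: the upper variation of \<open>A\<close> is the supremum of \<open>\<mu> B\<close> over the Borel subsets
  \<open>B\<close> of \<open>A\<close>.  Since \<open>ennreal\<close> truncates negative numbers and \<open>B = {}\<close> is admissible, the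
  truncation does not affect the supremum.
\<close>

definition upper_variation :: "(real set \<Rightarrow> real) \<Rightarrow> real measure" where
  "upper_variation \<mu> =
     measure_of UNIV (sets borel) (\<lambda>A. SUP B\<in>{B \<in> sets borel. B \<subseteq> A}. ennreal (\<mu> B))"

definition lower_variation :: "(real set \<Rightarrow> real) \<Rightarrow> real measure" where
  "lower_variation \<mu> = upper_variation (\<lambda>A. - \<mu> A)"

definition signed_integral :: "(real set \<Rightarrow> real) \<Rightarrow> (real \<Rightarrow> real) \<Rightarrow> real" where
  "signed_integral \<mu> \<phi> =
     (\<integral>t. \<phi> t \<partial>upper_variation \<mu>) - (\<integral>t. \<phi> t \<partial>lower_variation \<mu>)"

definition tv_norm :: "(real set \<Rightarrow> real) \<Rightarrow> real" where
  "tv_norm \<mu> = measure (upper_variation \<mu>) UNIV + measure (lower_variation \<mu>) UNIV"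


section \<open>Tempered distributions\<close>

text \<open>All functions are real-valued, so real-valued test functions suffice.\<close>

definition schwartz :: "(real \<Rightarrow> real) set" where
  "schwartz = {\<phi>. (\<forall>n x. (deriv ^^ n) \<phi> differentiable (at x)) \<and>
                  (\<forall>k n. bounded (range (\<lambda>x. x ^ k * (deriv ^^ n) \<phi> x)))}"

definition schwartz_seminorm :: "nat \<Rightarrow> nat \<Rightarrow> (real \<Rightarrow> real) \<Rightarrow> real" where
  "schwartz_seminorm k n \<phi> = (SUP x. \<bar>x ^ k * (deriv ^^ n) \<phi> x\<bar>)"

text \<open>
  Continuity of a linear functional for the Frechet topology of the Schwartz space means that it is
  bounded by finitely many of the defining seminorms.
\<close>

definition tempered_distribution :: "((real \<Rightarrow> real) \<Rightarrow> real) \<Rightarrow> bool" where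
  "tempered_distribution T \<longleftrightarrow>
     (\<forall>\<phi>\<in>schwartz. \<forall>\<psi>\<in>schwartz. \<forall>a b. T (\<lambda>x. a * \<phi> x + b * \<psi> x) = a * T \<phi> + b * T \<psi>) \<and>
     (\<exists>C N. \<forall>\<phi>\<in>schwartz. \<bar>T \<phi>\<bar> \<le> C * (\<Sum>k\<le>N. \<Sum>n\<le>N. schwartz_seminorm k n \<phi>))"

definition distr_D2 :: "((real \<Rightarrow> real) \<Rightarrow> real) \<Rightarrow> (real \<Rightarrow> real) \<Rightarrow> real" where
  "distr_D2 T \<phi> = T (deriv (deriv \<phi>))"

definition is_distr_measure :: "((real \<Rightarrow> real) \<Rightarrow> real) \<Rightarrow> (real set \<Rightarrow> real) \<Rightarrow> bool" where
  "is_distr_measure T \<mu> \<longleftrightarrow> signed_measure \<mu> \<and> (\<forall>\<phi>\<in>schwartz. T \<phi> = signed_integral \<mu> \<phi>)"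

definition distr_of_fun :: "(real \<Rightarrow> real) \<Rightarrow> (real \<Rightarrow> real) \<Rightarrow> real" where
  "distr_of_fun f \<phi> = (\<integral>x. f x * \<phi> x \<partial>lborel)"


section \<open>The space of functions of bounded second variation\<close>

definition BV2_distr :: "((real \<Rightarrow> real) \<Rightarrow> real) set" where
  "BV2_distr = {T. tempered_distribution T \<and> (\<exists>\<mu>. is_distr_measure (distr_D2 T) \<mu>)}"

text \<open>
  Every element of \<open>BV2_distr\<close> is given by a unique continuous function.  Point values and graphs
  refer to this representative, so the space is taken as the set of these functions.
\<close>

definition BV2 :: "(real \<Rightarrow> real) set" where
  "BV2 = {f. continuous_on UNIV f \<and>
             (\<forall>\<phi>\<in>schwartz. integrable lborel (\<lambda>x. f x * \<phi> x)) \<and>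
             distr_of_fun f \<in> BV2_distr}"

definition D2_measure :: "(real \<Rightarrow> real) \<Rightarrow> real set \<Rightarrow> real" where
  "D2_measure f = (THE \<mu>. is_distr_measure (distr_D2 (distr_of_fun f)) \<mu>)"


section \<open>The interpolation problem and its canonical solution\<close>

text \<open>Data points are indexed by \<open>1, \<dots>, M\<close>; values of \<open>x\<close> and \<open>y\<close> elsewhere are irrelevant.\<close>

definition gBPC_feasible :: "nat \<Rightarrow> (nat \<Rightarrow> real) \<Rightarrow> (nat \<Rightarrow> real) \<Rightarrow> (real \<Rightarrow> real) set" where
  "gBPC_feasible M x y = {f \<in> BV2. \<forall>m\<in>{1..M}. f (x m) = y m}"

definition gBPC_solutions :: "nat \<Rightarrow> (nat \<Rightarrow> real) \<Rightarrow> (nat \<Rightarrow> real) \<Rightarrow> (real \<Rightarrow> real) set" where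
  "gBPC_solutions M x y =
     {f \<in> gBPC_feasible M x y.
        \<forall>g\<in>gBPC_feasible M x y. tv_norm (D2_measure f) \<le> tv_norm (D2_measure g)}"

definition graph :: "(real \<Rightarrow> real) \<Rightarrow> (real \<times> real) set" where
  "graph f = {(t, f t) | t. t \<in> UNIV}"

definition cano_coeff :: "nat \<Rightarrow> (nat \<Rightarrow> real) \<Rightarrow> (nat \<Rightarrow> real) \<Rightarrow> nat \<Rightarrow> real" where
  "cano_coeff M x y m =
     (if m = 1 then (y 2 - y 1) / (x 2 - x 1)
      else if m = M then y 1 - (y 2 - y 1) / (x 2 - x 1) * x 1
      else (y (m + 1) - y m) / (x (m + 1) - x m) - (y m - y (m - 1)) / (x m - x (m - 1)))"

definition f_cano :: "nat \<Rightarrow> (nat \<Rightarrow> real) \<Rightarrow> (nat \<Rightarrow> real) \<Rightarrow> real \<Rightarrow> real" where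
  "f_cano M x y t =
     cano_coeff M x y 1 * t + cano_coeff M x y M +
     (\<Sum>m = 2..M - 1. cano_coeff M x y m * max 0 (t - x m))"

definition same_sign_indices :: "nat \<Rightarrow> (nat \<Rightarrow> real) \<Rightarrow> (nat \<Rightarrow> real) \<Rightarrow> nat set" where
  "same_sign_indices M x y =
     {m \<in> {2..M - 2}. cano_coeff M x y m * cano_coeff M x y (m + 1) > 0}"

definition data_point :: "(nat \<Rightarrow> real) \<Rightarrow> (nat \<Rightarrow> real) \<Rightarrow> nat \<Rightarrow> real \<times> real" where
  "data_point x y m = (x m, y m)"

definition apex :: "(nat \<Rightarrow> real) \<Rightarrow> (nat \<Rightarrow> real) \<Rightarrow> nat \<Rightarrow> real \<times> real" where
  "apex x y m =
     (THE p. p \<in> affine hull {data_point x y (m - 1), data_point x y m} \<inter>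
                 affine hull {data_point x y (m + 1), data_point x y (m + 2)})"

definition data_triangle :: "(nat \<Rightarrow> real) \<Rightarrow> (nat \<Rightarrow> real) \<Rightarrow> nat \<Rightarrow> (real \<times> real) set" where
  "data_triangle x y m = convex hull {data_point x y m, apex x y m, data_point x y (m + 1)}"

end

theory Submission
  imports Defs "HOL-Probability.Sinc_Integral"
begin

text \<open>
  Write \<open>s\<^sub>i\<close> for the slope of the data between nodes \<open>i\<close> and \<open>i + 1\<close>, and call \<open>s\<^sub>i - s\<^bsub>i-1\<^esub>\<close> the
  kink at node \<open>i\<close>.  Everything rests on one fact: the least second variation of a function that
  passes through given points is the sum of the absolute kinks of these points.

  \<^item> Lower bound (\<open>sum_kinks_le_tv_norm\<close>).  The norm of a measure bounds its integral against any test
    function with values in \<open>[-1, 1]\<close>.  The test function used here is a mollification of the piecewise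
    linear function that takes at each interior node the sign of the kink and vanishes at the
    two outer nodes.  Its second derivative is a combination of approximate point masses at the nodes,
    so that the integral tends to the sum of the absolute kinks.
  \<^item> Attainment (\<open>f_cano_BV2\<close>).  The second derivative of a linear spline is the sum of point masses
    at its knots, weighted by the slope changes; hence the canonical interpolant attains the bound.

  The same fact, applied to the data together with one more point \<open>(t, v)\<close>, decides which points lie on
  the graph of a solution: some solution passes through \<open>(t, v)\<close> if and only if inserting \<open>(t, v)\<close> into the data
  does not increase the sum of the absolute kinks (\<open>ex_solution_through_iff\<close>).  If a solution \<open>f\<close> has
  \<open>f t = v\<close>, the lower bound for the refined data applies to \<open>f\<close>; conversely the canonical interpolant of
  the refined data is then a solution of the original problem.

  What remains is elementary.  Let \<open>t\<close> lie strictly between the nodes \<open>m\<close> and \<open>m + 1\<close>, let \<open>a\<close> and \<open>b\<close> be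
  the kinks there, and let the point lie at signed depth \<open>w\<close> below the chord.  The insertion replaces the kinks
  \<open>a, b\<close> by \<open>a - P, P + Q, b - Q\<close>, where \<open>P\<close> and \<open>Q\<close> are \<open>w\<close> divided by the distances of \<open>t\<close> to the two nodes.
  By the triangle inequality the absolute sum stays the same only if \<open>w = 0\<close>, or if \<open>P\<close> lies between \<open>0\<close> and
  \<open>a\<close> and \<open>Q\<close> between \<open>0\<close> and \<open>b\<close> (\<open>mid_condition\<close>).  The second alternative forces \<open>a\<close> and \<open>b\<close> to have the same
  sign and says that the point lies between the chord and the extensions of the two neighbouring
  segments, which is the triangle (\<open>data_triangle_iff\<close>).  In the two outermost
  intervals one of the two kinks is missing; outside the data range the point creates a kink at the
  nearest end node, where there was none.  In these cases the sum increases unless the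
  point continues the adjacent line.
\<close>

section \<open>Finite signed measures and their variations\<close>

lemma signed_measure_sums:
  assumes "signed_measure \<mu>" "\<And>n::nat. A n \<in> sets borel" "disjoint_family A"
  shows "(\<lambda>n. \<mu> (A n)) sums \<mu> (\<Union>n. A n)"
  using assms unfolding signed_measure_def by blast

lemma signed_measure_Un:
  assumes \<mu>: "signed_measure \<mu>" and A: "A \<in> sets borel" and B: "B \<in> sets borel" and "A \<inter> B = {}"
  shows "\<mu> (A \<union> B) = \<mu> A + \<mu> B"
proof -
  have "(\<lambda>n. \<mu> (binaryset A B n)) sums \<mu> (\<Union>n. binaryset A B n)"
    using assms by (intro signed_measure_sums[OF \<mu>])
      (auto simp: binaryset_def disjoint_family_on_def)
  moreover have "(\<lambda>n. \<mu> (binaryset A B n)) sums (\<mu> A + \<mu> B)"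
    using \<mu> by (intro binaryset_sums) (simp add: signed_measure_def)
  ultimately show ?thesis
    by (simp add: UN_binaryset_eq sums_unique2)
qed

lemma signed_measure_Diff:
  assumes "signed_measure \<mu>" "A \<in> sets borel" "B \<in> sets borel" "B \<subseteq> A"
  shows "\<mu> (A - B) = \<mu> A - \<mu> B"
  using signed_measure_Un[OF assms(1,3) sets.Diff[OF assms(2,3)]] assms(4)
  by (simp add: Un_absorb1)

lemma signed_measure_uminus:
  assumes "signed_measure \<mu>"
  shows "signed_measure (\<lambda>A. - \<mu> A)"
  using assms unfolding signed_measure_def by (auto intro: sums_minus)

text \<open>
  Boundedness has to be proved because the upper variation is read off as a real number, which is \<open>0\<close>
  for an infinite mass.  A set on which the measure is unbounded splits into a piece
  of mass larger than \<open>1\<close> and a remainder that is again unbounded; iterating this gives disjoint pieces whose masses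
  do not tend to \<open>0\<close>.
\<close>
lemma signed_measure_bounded:
  assumes \<mu>: "signed_measure \<mu>"
  obtains K where "\<And>A. \<bar>\<mu> A\<bar> \<le> K"
proof -
  define bad where "bad E \<longleftrightarrow> E \<in> sets borel \<and> (\<forall>K. \<exists>A\<in>sets borel. A \<subseteq> E \<and> \<bar>\<mu> A\<bar> > K)" for E
  have split: "\<exists>F. bad F \<and> F \<subseteq> E \<and> \<bar>\<mu> (E - F)\<bar> > 1" if E: "bad E" for E
  proof -
    obtain A where A: "A \<in> sets borel" "A \<subseteq> E" "\<bar>\<mu> A\<bar> > 1 + \<bar>\<mu> E\<bar>"
      using E unfolding bad_def by blast
    have E': "E \<in> sets borel" using E by (simp add: bad_def)
    have big: "\<bar>\<mu> (E - A)\<bar> > 1" "\<bar>\<mu> A\<bar> > 1"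
      using signed_measure_Diff[OF \<mu> E' A(1,2)] A(3) by auto
    have "bad A \<or> bad (E - A)"
    proof (rule ccontr)
      assume "\<not> ?thesis"
      moreover have "\<exists>K. \<forall>B\<in>sets borel. B \<subseteq> F \<longrightarrow> \<bar>\<mu> B\<bar> \<le> K"
        if "\<not> bad F" "F \<in> sets borel" for F
        using that unfolding bad_def not_less[symmetric] by blast
      ultimately obtain K L where
        K: "\<And>B. B \<in> sets borel \<Longrightarrow> B \<subseteq> A \<Longrightarrow> \<bar>\<mu> B\<bar> \<le> K" and
        L: "\<And>B. B \<in> sets borel \<Longrightarrow> B \<subseteq> E - A \<Longrightarrow> \<bar>\<mu> B\<bar> \<le> L"
        using A(1) sets.Diff[OF E' A(1)] by metis
      obtain B where B: "B \<in> sets borel" "B \<subseteq> E" "\<bar>\<mu> B\<bar> > K + L"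
        using E unfolding bad_def by blast
      have "\<mu> B = \<mu> (B \<inter> A) + \<mu> (B - A)"
        using signed_measure_Un[OF \<mu>, of "B \<inter> A" "B - A"] A(1) B(1) by (simp add: Int_Diff_Un Int_Diff_disjoint)
      moreover have "\<bar>\<mu> (B \<inter> A)\<bar> \<le> K" "\<bar>\<mu> (B - A)\<bar> \<le> L"
        using A(1) B by (auto intro!: K L)
      ultimately show False using B(3) by linarith
    qed
    moreover have "E - (E - A) = A" using A(2) by blast
    ultimately show ?thesis using big A(2) by (metis Diff_subset)
  qed
  have "\<not> bad UNIV"
  proof
    assume bad: "bad UNIV"
    obtain next_bad where nb: "\<And>E. bad E \<Longrightarrow> bad (next_bad E) \<and> next_bad E \<subseteq> E \<and> \<bar>\<mu> (E - next_bad E)\<bar> > 1"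
      using split by metis
    define F where "F n = (next_bad ^^ n) UNIV" for n
    have F: "bad (F n)" for n
      by (induction n) (auto simp: F_def bad nb)
    have step: "F (Suc n) \<subseteq> F n" "\<bar>\<mu> (F n - F (Suc n))\<bar> > 1" for n
      using nb[OF F[of n]] by (auto simp: F_def)
    have anti: "F n \<subseteq> F m" if "m \<le> n" for m n
      using that step(1) by (rule lift_Suc_antimono_le[rotated])
    have disj: "disjoint_family (\<lambda>n. F n - F (Suc n))"
      unfolding disjoint_family_on_def
    proof (intro ballI impI)
      fix m n :: nat assume "m \<noteq> n"
      then consider "Suc m \<le> n" | "Suc n \<le> m" by linarith
      then show "(F m - F (Suc m)) \<inter> (F n - F (Suc n)) = {}"
        by cases (use anti in blast)+
    qed
    have "(\<lambda>n. \<mu> (F n - F (Suc n))) sums \<mu> (\<Union>n. F n - F (Suc n))"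
      using F by (intro signed_measure_sums[OF \<mu>] disj) (auto simp: bad_def)
    then have "(\<lambda>n. \<mu> (F n - F (Suc n))) \<longlonglongrightarrow> 0"
      by (intro summable_LIMSEQ_zero sums_summable)
    then have "\<forall>\<^sub>F n in sequentially. \<bar>\<mu> (F n - F (Suc n))\<bar> < 1"
      using LIMSEQ_iff[of "\<lambda>n. \<mu> (F n - F (Suc n))" 0] by (auto simp: eventually_sequentially intro: zero_less_one)
    then show False using step(2) by (auto simp: eventually_sequentially not_less intro: less_imp_le) (metis less_asym order_refl)
  qed
  then obtain K where K: "\<And>A. A \<in> sets borel \<Longrightarrow> \<bar>\<mu> A\<bar> \<le> K"
    unfolding bad_def by (auto simp: not_less)
  have "\<bar>\<mu> A\<bar> \<le> max K 0" for A
    using K[of A] \<mu> unfolding signed_measure_def by (cases "A \<in> sets borel") auto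
  then show thesis by (rule that)
qed

lemma sets_upper_variation [simp, measurable_cong]: "sets (upper_variation \<mu>) = sets borel"
  unfolding upper_variation_def using sets.sigma_sets_eq[of "borel :: real measure"]
  by simp

lemma space_upper_variation [simp]: "space (upper_variation \<mu>) = UNIV"
  unfolding upper_variation_def by (simp add: space_measure_of_conv)

text \<open>
  The supremum formula is countably additive, so \<open>measure_of\<close> does not fall back to the zero measure.
  Superadditivity holds because nearly optimal subsets of disjoint sets can be united, and countable
  subadditivity because a subset of a union can be cut into its traces.
\<close>
lemma emeasure_upper_variation:
  assumes \<mu>: "signed_measure \<mu>" and A: "A \<in> sets borel"
  shows "emeasure (upper_variation \<mu>) A = (SUP B\<in>{B \<in> sets borel. B \<subseteq> A}. ennreal (\<mu> B))"
proof -
  define U where "U A = (SUP B\<in>{B \<in> sets borel. B \<subseteq> A}. ennreal (\<mu> B))" for A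
  have upper: "ennreal (\<mu> B) \<le> U A" if "B \<in> sets borel" "B \<subseteq> A" for A B
    unfolding U_def using that by (auto intro: SUP_upper)
  have mono: "U A \<le> U B" if "A \<subseteq> B" for A B
    unfolding U_def using that by (intro SUP_subset_mono) auto
  have empty: "U {} = 0"
  proof -
    have "{B \<in> sets borel. B \<subseteq> ({} :: real set)} = {{}}" by auto
    then show ?thesis unfolding U_def using \<mu> by (simp add: signed_measure_def)
  qed
  have super: "U A + U B \<le> U (A \<union> B)"
    if "A \<inter> B = {}" for A B
  proof -
    have "ennreal (\<mu> A') + ennreal (\<mu> B') \<le> U (A \<union> B)"
      if A': "A' \<in> sets borel" "A' \<subseteq> A" and B': "B' \<in> sets borel" "B' \<subseteq> B" for A' B'
    proof (cases "\<mu> A' \<le> 0 \<or> \<mu> B' \<le> 0")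
      case True
      have "A' \<subseteq> A \<union> B" "B' \<subseteq> A \<union> B" using A' B' by auto
      then show ?thesis using True upper[OF A'(1)] upper[OF B'(1)] by (auto simp: ennreal_neg)
    next
      case False
      have "ennreal (\<mu> A') + ennreal (\<mu> B') = ennreal (\<mu> (A' \<union> B'))"
        using False A' B' \<open>A \<inter> B = {}\<close>
        by (subst signed_measure_Un[OF \<mu>]) (auto simp: ennreal_plus)
      also have "\<dots> \<le> U (A \<union> B)" using A' B' by (intro upper) auto
      finally show ?thesis .
    qed
    then have "ennreal (\<mu> A') + U B \<le> U (A \<union> B)" if "A' \<in> sets borel" "A' \<subseteq> A" for A'
      unfolding U_def[of B] using that
      by (subst ennreal_SUP_add_right) (auto intro!: SUP_least)
    then show ?thesis
      unfolding U_def[of A] by (subst ennreal_SUP_add_left[symmetric]) (auto intro!: SUP_least)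
  qed
  have "countably_additive (sets borel) U"
    unfolding countably_additive_def
  proof (intro allI impI)
    fix A :: "nat \<Rightarrow> real set"
    assume A: "range A \<subseteq> sets borel" and disj: "disjoint_family A"
    show "(\<Sum>n. U (A n)) = U (\<Union> (range A))"
    proof (rule antisym)
      have fin: "(\<Sum>n<N. U (A n)) \<le> U (\<Union>n<N. A n)" for N
      proof (induction N)
        case (Suc N)
        have "(\<Sum>n<Suc N. U (A n)) \<le> U (\<Union>n<N. A n) + U (A N)"
          using Suc by (simp add: add_mono)
        also have "\<dots> \<le> U ((\<Union>n<N. A n) \<union> A N)"
        proof (rule super)
          have "A n \<inter> A N = {}" if "n < N" for n
            using disjoint_family_onD[OF disj] that by simp
          then show "(\<Union>n<N. A n) \<inter> A N = {}" by auto
        qed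
        also have "(\<Union>n<N. A n) \<union> A N = (\<Union>n<Suc N. A n)"
          by (auto simp: lessThan_Suc)
        finally show ?case .
      qed (simp add: empty)
      show "(\<Sum>n. U (A n)) \<le> U (\<Union> (range A))"
      proof (rule suminf_le_const)
        show "(\<Sum>n<N. U (A n)) \<le> U (\<Union> (range A))" for N
          using fin[of N] by (rule order_trans) (auto intro!: mono)
      qed simp
      show "U (\<Union> (range A)) \<le> (\<Sum>n. U (A n))"
        unfolding U_def[of "\<Union> (range A)"]
      proof (rule SUP_least, clarify)
        fix B :: "real set" assume B: "B \<in> sets borel" "B \<subseteq> \<Union> (range A)"
        have "(\<lambda>n. \<mu> (B \<inter> A n)) sums \<mu> (\<Union>n. B \<inter> A n)"
          using A B disjoint_family_on_bisimulation[OF disj, of "\<lambda>n. B \<inter> A n"]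
          by (intro signed_measure_sums[OF \<mu>]) auto
        also have "(\<Union>n. B \<inter> A n) = B" using B(2) by auto
        finally have "(\<lambda>N. ennreal (\<Sum>n<N. \<mu> (B \<inter> A n))) \<longlonglongrightarrow> ennreal (\<mu> B)"
          by (intro tendsto_ennrealI) (simp add: sums_def)
        then show "ennreal (\<mu> B) \<le> (\<Sum>n. U (A n))"
        proof (rule LIMSEQ_le_const2, intro exI allI impI)
          fix N :: nat
          have "ennreal (\<Sum>n<N. \<mu> (B \<inter> A n)) \<le> ennreal (\<Sum>n<N. max 0 (\<mu> (B \<inter> A n)))"
            by (intro ennreal_leI sum_mono) auto
          also have "\<dots> = (\<Sum>n<N. ennreal (max 0 (\<mu> (B \<inter> A n))))"
            by (subst sum_ennreal) auto
          also have "\<dots> \<le> (\<Sum>n<N. U (A n))"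
            using A B by (intro sum_mono) (auto simp: max_def intro!: upper)
          also have "\<dots> \<le> (\<Sum>n. U (A n))" by (intro sum_le_suminf) auto
          finally show "ennreal (\<Sum>n<N. \<mu> (B \<inter> A n)) \<le> (\<Sum>n. U (A n))" .
        qed
      qed
    qed
  qed
  then have "emeasure (measure_of UNIV (sets borel) U) A = U A"
    using A empty by (intro emeasure_measure_of_sigma)
      (auto simp: positive_def sets.sigma_algebra_axioms[of borel, simplified])
  then show ?thesis unfolding upper_variation_def U_def .
qed

lemma finite_measure_upper_variation:
  assumes "signed_measure \<mu>"
  shows "finite_measure (upper_variation \<mu>)"
proof -
  obtain K where K: "\<And>A. \<bar>\<mu> A\<bar> \<le> K" using signed_measure_bounded[OF assms] by blast
  have "emeasure (upper_variation \<mu>) UNIV \<le> ennreal K"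
    using K by (subst emeasure_upper_variation[OF assms])
      (auto intro!: SUP_least ennreal_leI intro: order_trans[OF abs_ge_self])
  then show ?thesis by (intro finite_measureI) (auto simp: top_unique)
qed

lemma le_measure_upper_variation:
  assumes "signed_measure \<mu>" "A \<in> sets borel" "B \<in> sets borel" "B \<subseteq> A"
  shows "\<mu> B \<le> measure (upper_variation \<mu>) A"
proof -
  interpret finite_measure "upper_variation \<mu>" by (rule finite_measure_upper_variation[OF assms(1)])
  have "ennreal (\<mu> B) \<le> emeasure (upper_variation \<mu>) A"
    using assms by (subst emeasure_upper_variation) (auto intro: SUP_upper)
  then show ?thesis by (simp add: emeasure_eq_measure ennreal_le_iff)
qed

lemma measure_upper_variation_le:
  assumes "signed_measure \<mu>" "A \<in> sets borel"
    and "\<And>B. B \<in> sets borel \<Longrightarrow> B \<subseteq> A \<Longrightarrow> \<mu> B \<le> c"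
  shows "measure (upper_variation \<mu>) A \<le> c"
proof -
  have "c \<ge> 0" using assms(3)[of "{}"] assms(1) by (simp add: signed_measure_def)
  moreover have "emeasure (upper_variation \<mu>) A \<le> ennreal c"
    using assms by (subst emeasure_upper_variation) (auto intro!: SUP_least ennreal_leI)
  ultimately show ?thesis unfolding measure_def by (metis enn2real_leI)
qed

text \<open>
  Jordan decomposition.  For \<open>B \<subseteq> A\<close> one has \<open>\<mu> B = \<mu> A - \<mu> (A - B)\<close>; the supremum over \<open>B\<close> bounds the upper
  variation by \<open>\<mu> A\<close> plus the lower one, and exchanging \<open>\<mu>\<close> with \<open>-\<mu>\<close> gives the other inequality.
\<close>
lemma signed_measure_eq_upper_minus_lower:
  assumes \<mu>: "signed_measure \<mu>" and A: "A \<in> sets borel"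
  shows "\<mu> A = measure (upper_variation \<mu>) A - measure (lower_variation \<mu>) A"
proof -
  have le: "measure (upper_variation \<nu>) A \<le> \<nu> A + measure (lower_variation \<nu>) A"
    if \<nu>: "signed_measure \<nu>" for \<nu>
  proof (rule measure_upper_variation_le[OF \<nu> A])
    fix B :: "real set" assume B: "B \<in> sets borel" "B \<subseteq> A"
    have "- \<nu> (A - B) \<le> measure (lower_variation \<nu>) A"
      unfolding lower_variation_def using A B
      by (intro le_measure_upper_variation[OF signed_measure_uminus[OF \<nu>]]) auto
    then show "\<nu> B \<le> \<nu> A + measure (lower_variation \<nu>) A"
      using signed_measure_Diff[OF \<nu> A B] by simp
  qed
  show ?thesis
    using le[OF \<mu>] le[OF signed_measure_uminus[OF \<mu>]] by (simp add: lower_variation_def)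
qed

lemma abs_signed_integral_le_tv_norm:
  assumes \<mu>: "signed_measure \<mu>" and \<phi>: "\<phi> \<in> borel_measurable borel" "\<And>t. \<bar>\<phi> t\<bar> \<le> 1"
  shows "\<bar>signed_integral \<mu> \<phi>\<bar> \<le> tv_norm \<mu>"
proof -
  have le: "\<bar>\<integral>t. \<phi> t \<partial>upper_variation \<nu>\<bar> \<le> measure (upper_variation \<nu>) UNIV"
    if \<nu>: "signed_measure \<nu>" for \<nu>
  proof -
    interpret finite_measure "upper_variation \<nu>" by (rule finite_measure_upper_variation[OF \<nu>])
    have "\<bar>\<integral>t. \<phi> t \<partial>upper_variation \<nu>\<bar> \<le> (\<integral>t. \<bar>\<phi> t\<bar> \<partial>upper_variation \<nu>)"
      by (rule integral_abs_bound)
    also have "\<dots> \<le> (\<integral>t. 1 \<partial>upper_variation \<nu>)"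
      using \<phi> by (intro integral_mono integrable_const_bound[where B = 1]) (auto cong: measurable_cong_sets)
    finally show ?thesis by simp
  qed
  show ?thesis
    using le[OF \<mu>] le[OF signed_measure_uminus[OF \<mu>]]
    unfolding signed_integral_def tv_norm_def lower_variation_def by linarith
qed

text \<open>
  Half-open intervals form a generator that is stable under intersection.  Closure under complements needs equality
  on the whole line, which is obtained in the limit from growing intervals.
\<close>
lemma signed_measure_eqI:
  assumes \<mu>: "signed_measure \<mu>" and \<nu>: "signed_measure \<nu>"
    and eq: "\<And>a b. a < b \<Longrightarrow> \<mu> {a<..b} = \<nu> {a<..b}"
  shows "\<mu> = \<nu>"
proof
  have lim: "(\<lambda>n. \<rho> {- real n<..real n}) \<longlonglongrightarrow> \<rho> UNIV" if \<rho>: "signed_measure \<rho>" for \<rho>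
  proof -
    have "(\<lambda>n. measure (upper_variation \<sigma>) {- real n<..real n}) \<longlonglongrightarrow> measure (upper_variation \<sigma>) UNIV"
      if "signed_measure \<sigma>" for \<sigma>
    proof -
      interpret finite_measure "upper_variation \<sigma>" by (rule finite_measure_upper_variation[OF that])
      have "(\<Union>n. {- real n<..real n}) = UNIV"
        by auto (meson abs_less_iff less_imp_le minus_less_iff reals_Archimedean2)
      moreover have "incseq (\<lambda>n. {- real n<..real n})"
        by (auto simp: incseq_def)
      ultimately show ?thesis
        using finite_Lim_measure_incseq[of "\<lambda>n. {- real n<..real n}"] by force
    qed
    from tendsto_diff[OF this[OF \<rho>] this[OF signed_measure_uminus[OF \<rho>]]] show ?thesis
      using signed_measure_eq_upper_minus_lower[OF \<rho>] by (simp add: lower_variation_def)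
  qed
  have eq': "\<mu> {a<..b} = \<nu> {a<..b}" for a b
    using eq[of a b] \<mu> \<nu> by (cases "a < b") (auto simp: signed_measure_def)
  have UNIV: "\<mu> UNIV = \<nu> UNIV"
    using lim[OF \<mu>] lim[OF \<nu>] unfolding eq' by (rule LIMSEQ_unique)
  fix A :: "real set"
  show "\<mu> A = \<nu> A"
  proof (cases "A \<in> sets borel")
    case True
    let ?G = "range (\<lambda>(a, b). {a<..b :: real})"
    have "Int_stable ?G" by (auto simp: Int_stable_def)
    moreover have "?G \<subseteq> Pow UNIV" by simp
    moreover have b: "sets borel = sigma_sets UNIV ?G"
      by (subst borel_sigma_sets_Ioc) (simp add: sets_measure_of)
    then have "A \<in> sigma_sets UNIV ?G" using True by simp
    ultimately show ?thesis
    proof (induction rule: sigma_sets_induct_disjoint)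
      case (basic A) then show ?case using eq' by auto
    next
      case empty show ?case using \<mu> \<nu> by (simp add: signed_measure_def)
    next
      case (compl A)
      then have "A \<in> sets borel" by (simp only: b)
      then show ?case
        using compl(2) signed_measure_Diff[OF \<mu>, of UNIV A] signed_measure_Diff[OF \<nu>, of UNIV A] UNIV
        by simp
    next
      case (union A)
      have A: "A n \<in> sets borel" for n using union(2) b by auto
      show ?case
        using signed_measure_sums[OF \<mu> A union(1)] signed_measure_sums[OF \<nu> A union(1)] union(3)
        by (simp add: sums_unique2)
    qed
  next
    case False then show ?thesis using \<mu> \<nu> by (simp add: signed_measure_def)
  qed
qed

section \<open>Smooth functions with compact support\<close>

text \<open>
  Recursion on the first derivative, rather than iteration of \<open>deriv\<close>, makes closure under sums and
  products a plain induction.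
\<close>
primrec times_differentiable :: "nat \<Rightarrow> (real \<Rightarrow> real) \<Rightarrow> bool" where
  "times_differentiable 0 f \<longleftrightarrow> True"
| "times_differentiable (Suc n) f \<longleftrightarrow>
     (\<exists>f'. (\<forall>x. (f has_real_derivative f' x) (at x)) \<and> times_differentiable n f')"

definition smooth :: "(real \<Rightarrow> real) \<Rightarrow> bool" where
  "smooth f \<longleftrightarrow> (\<forall>n. times_differentiable n f)"

lemma times_differentiable_SucD: "times_differentiable (Suc n) f \<Longrightarrow> times_differentiable n f"
  by (induction n arbitrary: f) auto

lemma times_differentiable_const: "times_differentiable n (\<lambda>x. c)"
proof (induction n arbitrary: c)
  case (Suc n)
  then show ?case by (auto intro!: exI[of _ "\<lambda>x. 0"])
qed simp

lemma times_differentiable_add: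
  "times_differentiable n f \<Longrightarrow> times_differentiable n g \<Longrightarrow> times_differentiable n (\<lambda>x. f x + g x)"
proof (induction n arbitrary: f g)
  case (Suc n)
  obtain f' where f': "\<And>x. (f has_real_derivative f' x) (at x)" "times_differentiable n f'"
    using Suc.prems by auto
  obtain g' where g': "\<And>x. (g has_real_derivative g' x) (at x)" "times_differentiable n g'"
    using Suc.prems by auto
  have "((\<lambda>x. f x + g x) has_real_derivative f' x + g' x) (at x)" for x
    using DERIV_add[OF f'(1) g'(1)] .
  then show ?case using Suc.IH[OF f'(2) g'(2)] by (auto intro!: exI[of _ "\<lambda>x. f' x + g' x"])
qed simp

lemma times_differentiable_mult:
  "times_differentiable n f \<Longrightarrow> times_differentiable n g \<Longrightarrow> times_differentiable n (\<lambda>x. f x * g x)"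
proof (induction n arbitrary: f g)
  case (Suc n)
  obtain f' where f': "\<And>x. (f has_real_derivative f' x) (at x)" "times_differentiable n f'"
    using Suc.prems by auto
  obtain g' where g': "\<And>x. (g has_real_derivative g' x) (at x)" "times_differentiable n g'"
    using Suc.prems by auto
  have "times_differentiable n f" "times_differentiable n g"
    using Suc.prems by (auto intro: times_differentiable_SucD simp del: times_differentiable.simps)
  then have "times_differentiable n (\<lambda>x. f' x * g x + g' x * f x)"
    using f' g' by (intro times_differentiable_add Suc.IH)
  moreover have "((\<lambda>x. f x * g x) has_real_derivative f' x * g x + g' x * f x) (at x)" for x
    using DERIV_mult[OF f'(1) g'(1)] .
  ultimately show ?case by (auto intro!: exI[of _ "\<lambda>x. f' x * g x + g' x * f x"])
qed simp

lemma times_differentiable_affine: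
  "times_differentiable n f \<Longrightarrow> times_differentiable n (\<lambda>x. f (a * x + b))"
proof (induction n arbitrary: f)
  case (Suc n)
  obtain f' where f': "\<And>x. (f has_real_derivative f' x) (at x)" "times_differentiable n f'"
    using Suc.prems by auto
  have "((\<lambda>x. f (a * x + b)) has_real_derivative f' (a * x + b) * a) (at x)" for x
    by (rule DERIV_chain2[OF f'(1)]) (auto intro!: derivative_eq_intros)
  moreover have "times_differentiable n (\<lambda>x. f' (a * x + b) * a)"
    using Suc.IH[OF f'(2)] by (intro times_differentiable_mult times_differentiable_const)
  ultimately show ?case by (auto intro!: exI[of _ "\<lambda>x. f' (a * x + b) * a"])
qed simp

lemma smooth_const: "smooth (\<lambda>x. c)"
  by (simp add: smooth_def times_differentiable_const)

lemma smooth_add: "smooth f \<Longrightarrow> smooth g \<Longrightarrow> smooth (\<lambda>x. f x + g x)"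
  by (simp add: smooth_def times_differentiable_add)

lemma smooth_mult: "smooth f \<Longrightarrow> smooth g \<Longrightarrow> smooth (\<lambda>x. f x * g x)"
  by (simp add: smooth_def times_differentiable_mult)

lemma smooth_diff: "smooth f \<Longrightarrow> smooth g \<Longrightarrow> smooth (\<lambda>x. f x - g x)"
  using smooth_add[OF _ smooth_mult[OF smooth_const[of "-1"]], of f g] by simp

lemma smooth_divide_const: "smooth f \<Longrightarrow> smooth (\<lambda>x. f x / c)"
  using smooth_mult[OF _ smooth_const[of "inverse c"], of f] by (simp add: divide_inverse)

lemma smooth_sum:
  assumes "\<And>i. i \<in> I \<Longrightarrow> smooth (f i)"
  shows "smooth (\<lambda>x. \<Sum>i\<in>I. f i x)"
  using assms by (induction I rule: infinite_finite_induct) (auto intro: smooth_const smooth_add)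

lemma smooth_affine: "smooth f \<Longrightarrow> smooth (\<lambda>x. f (a * x + b))"
  by (simp add: smooth_def times_differentiable_affine)

lemma smooth_antiderivative:
  assumes "\<And>x. (F has_real_derivative f x) (at x)" "smooth f"
  shows "smooth F"
  unfolding smooth_def
proof
  fix n show "times_differentiable n F"
    using assms by (cases n) (auto simp: smooth_def)
qed

lemma smooth_continuous_on:
  assumes "smooth f" shows "continuous_on A f"
proof -
  have "times_differentiable 1 f" using assms by (simp only: smooth_def)
  then obtain f' where "\<And>x. (f has_real_derivative f' x) (at x)" by auto
  then show ?thesis
    by (intro DERIV_continuous_on) (rule has_field_derivative_at_within)
qed

lemma differentiable_funpow_deriv:
  assumes "smooth f"
  shows "(deriv ^^ n) f differentiable (at x)"
proof -
  have "times_differentiable (Suc n) f \<Longrightarrow> (deriv ^^ n) f differentiable (at x)" for f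
  proof (induction n arbitrary: f)
    case 0
    then show ?case by (auto simp: real_differentiable_def)
  next
    case (Suc n)
    obtain f' where f': "\<And>x. (f has_real_derivative f' x) (at x)" "times_differentiable (Suc n) f'"
      using Suc.prems by (subst (asm) times_differentiable.simps) blast
    then have "deriv f = f'" by (intro ext DERIV_imp_deriv)
    then show ?case using Suc.IH[OF f'(2)] by (simp add: funpow_Suc_right del: funpow.simps)
  qed
  then show ?thesis using assms unfolding smooth_def by blast
qed

lemma funpow_deriv_eq_0_outside:
  fixes f :: "real \<Rightarrow> real"
  assumes "\<And>x. x \<notin> {a..b} \<Longrightarrow> f x = 0" "x \<notin> {a..b}"
  shows "(deriv ^^ n) f x = 0"
  using assms(2)
proof (induction n arbitrary: x)
  case (Suc n)
  have "\<forall>\<^sub>F y in nhds x. y \<in> - {a..b}"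
    using Suc.prems by (intro eventually_nhds_in_open) auto
  then have "\<forall>\<^sub>F y in nhds x. (deriv ^^ n) f y = 0"
    by eventually_elim (use Suc.IH in auto)
  then have "deriv ((deriv ^^ n) f) x = deriv (\<lambda>_. 0) x"
    by (rule deriv_cong_ev) simp
  then show ?case by simp
qed (use assms(1) in auto)

text \<open>
  All derivatives vanish outside the support and are continuous on it, hence bounded together with
  all their polynomial multiples.
\<close>
lemma schwartz_compact_support:
  assumes f: "smooth f" and supp: "\<And>x. x \<notin> {a..b} \<Longrightarrow> f x = 0"
  shows "f \<in> schwartz"
proof -
  have "bounded (range (\<lambda>x. x ^ k * (deriv ^^ n) f x))" for k n
  proof -
    let ?g = "\<lambda>x. x ^ k * (deriv ^^ n) f x"
    have "continuous_on {a..b} ((deriv ^^ n) f)"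
      using differentiable_funpow_deriv[OF f]
      by (intro differentiable_imp_continuous_on) (auto simp: differentiable_on_def intro: differentiable_at_withinI)
    then have "compact (?g ` {a..b})"
      by (intro compact_continuous_image continuous_intros) auto
    then have "bounded (insert 0 (?g ` {a..b}))"
      using compact_imp_bounded by simp
    moreover have "range ?g \<subseteq> insert 0 (?g ` {a..b})"
    proof
      fix y assume "y \<in> range ?g"
      then obtain x where "y = ?g x" by blast
      then show "y \<in> insert 0 (?g ` {a..b})"
        using funpow_deriv_eq_0_outside[of a b f x n] supp by (cases "x \<in> {a..b}") auto
    qed
    ultimately show ?thesis by (rule bounded_subset)
  qed
  then show ?thesis
    unfolding schwartz_def using differentiable_funpow_deriv[OF f] by blast
qed

text \<open>
  For \<open>p = 1\<close> this is the standard example of a smooth function that is flat at \<open>0\<close>.  Carrying a polynomial in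
  \<open>1 / x\<close> as a factor makes the family closed under differentiation.
\<close>
definition flat :: "real poly \<Rightarrow> real \<Rightarrow> real" where
  "flat p x = (if x > 0 then poly p (1 / x) * exp (- (1 / x)) else 0)"

lemma poly_over_exp_tendsto_0: "((\<lambda>u::real. poly p u * exp (- u)) \<longlongrightarrow> 0) at_top"
proof -
  have "((\<lambda>u::real. \<Sum>i\<le>degree p. coeff p i * (u ^ i / exp u)) \<longlongrightarrow> (\<Sum>i\<le>degree p. coeff p i * 0)) at_top"
    by (intro tendsto_intros tendsto_power_div_exp_0)
  then show ?thesis
    by (simp add: poly_altdef sum_distrib_right exp_minus divide_inverse mult.assoc)
qed

lemma flat_has_derivative:
  "(flat p has_real_derivative flat ([:0, 0, 1:] * (p - pderiv p)) x) (at x)"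
proof -
  consider "x > 0" | "x < 0" | "x = 0" by linarith
  then show ?thesis
  proof cases
    case 1
    have "((\<lambda>x. poly p (1 / x) * exp (- (1 / x))) has_real_derivative
        flat ([:0, 0, 1:] * (p - pderiv p)) x) (at x)"
      using 1 by (auto intro!: derivative_eq_intros DERIV_chain2[OF poly_DERIV]
          simp: flat_def field_simps power2_eq_square)
    moreover have "\<forall>\<^sub>F y in nhds x. flat p y = poly p (1 / y) * exp (- (1 / y))"
      using eventually_nhds_in_open[of "{0<..}" x, simplified, OF 1] by eventually_elim (simp add: flat_def)
    ultimately show ?thesis by (subst DERIV_cong_ev) auto
  next
    case 2
    have "\<forall>\<^sub>F y in nhds x. flat p y = 0"
      using eventually_nhds_in_open[of "{..<0}" x, simplified, OF 2] by eventually_elim (simp add: flat_def)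
    then have "(flat p has_real_derivative 0) (at x)" by (subst DERIV_cong_ev) auto
    then show ?thesis using 2 by (simp add: flat_def)
  next
    case 3
    have "((\<lambda>y. flat p y / y) \<longlongrightarrow> 0) (at_right 0)"
    proof -
      have "((\<lambda>y. poly (pCons 0 p) (inverse y) * exp (- inverse y)) \<longlongrightarrow> 0) (at_right (0::real))"
        by (rule filterlim_compose[OF poly_over_exp_tendsto_0 filterlim_inverse_at_top_right])
      moreover have "\<forall>\<^sub>F y in at_right (0::real). poly (pCons 0 p) (inverse y) * exp (- inverse y) = flat p y / y"
        by (auto simp: eventually_at_filter flat_def divide_inverse)
      ultimately show ?thesis by (rule Lim_transform_eventually)
    qed
    moreover have "((\<lambda>y. flat p y / y) \<longlongrightarrow> 0) (at_left 0)"
      by (rule Lim_transform_eventually[OF tendsto_const])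
        (auto simp: eventually_at_filter flat_def)
    ultimately have "((\<lambda>y. flat p y / y) \<longlongrightarrow> 0) (at 0)"
      by (simp add: filterlim_split_at)
    then show ?thesis using 3 by (simp add: has_field_derivative_iff flat_def)
  qed
qed

lemma smooth_flat: "smooth (flat p)"
proof -
  have "times_differentiable n (flat p)" for n p
    by (induction n arbitrary: p) (use flat_has_derivative in auto)
  then show ?thesis by (simp add: smooth_def)
qed

lemma ex_antiderivative:
  fixes f :: "real \<Rightarrow> real"
  assumes "continuous_on UNIV f"
  obtains F where "\<And>x. (F has_real_derivative f x) (at x)"
proof -
  have "\<exists>F. \<forall>x::real. -\<infinity> < ereal x \<longrightarrow> ereal x < \<infinity> \<longrightarrow> (F has_vector_derivative f x) (at x)"
    using assms by (intro einterval_antiderivative) (auto simp: continuous_on_eq_continuous_at)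
  then show thesis using that by (auto simp: has_real_derivative_iff_has_vector_derivative)
qed

lemma zero_derivative_imp_eq:
  fixes F :: "real \<Rightarrow> real"
  assumes "convex A" "\<And>t. t \<in> A \<Longrightarrow> (F has_real_derivative 0) (at t)" "x \<in> A" "y \<in> A"
  shows "F x = F y"
  using has_field_derivative_zero_constant[OF assms(1), of F] assms(2-4)
  by (metis has_field_derivative_at_within)

text \<open>
  The second antiderivative \<open>R\<close> of a bump \<open>\<rho>\<close> of mass \<open>1\<close> is a smooth version of \<open>x \<mapsto> max 0 x\<close>: differences
  of its derivative \<open>S\<close> approximate indicator functions of intervals, and second differences of \<open>R\<close> approximate
  hat functions.
\<close>
lemma ex_smooth_ramp:
  obtains R S \<rho> :: "real \<Rightarrow> real" and c :: real where
    "smooth R" "smooth S" "smooth \<rho>"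
    "\<And>x. (R has_real_derivative S x) (at x)" "\<And>x. (S has_real_derivative \<rho> x) (at x)"
    "\<And>x. \<rho> x \<ge> 0" "\<And>x. x \<notin> {0..1} \<Longrightarrow> \<rho> x = 0"
    "mono S" "\<And>x. S x \<in> {0..1}"
    "\<And>x. x \<le> 0 \<Longrightarrow> S x = 0" "\<And>x. x \<ge> 1 \<Longrightarrow> S x = 1"
    "\<And>x. x \<le> 0 \<Longrightarrow> R x = 0" "\<And>x. x \<ge> 1 \<Longrightarrow> R x = x - c"
proof -
  \<comment> \<open>a bump that is positive exactly on the open unit interval\<close>
  define b where "b x = flat 1 x * flat 1 (1 - x)" for x
  have b: "smooth b"
    using smooth_mult[OF smooth_flat[of 1] smooth_affine[OF smooth_flat[of 1], of "-1" 1]]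
    by (simp add: b_def[abs_def])
  have b_nonneg: "b x \<ge> 0" for x by (simp add: b_def flat_def)
  have b_pos: "b x > 0" if "0 < x" "x < 1" for x using that by (simp add: b_def flat_def)
  have b_zero: "b x = 0" if "x \<le> 0 \<or> 1 \<le> x" for x using that by (auto simp: b_def flat_def)
  obtain F where F: "\<And>x. (F has_real_derivative b x) (at x)"
    using ex_antiderivative[OF smooth_continuous_on[OF b]] by blast
  have F_left: "F x = F 0" if "x \<le> 0" for x
    using that F b_zero by (intro zero_derivative_imp_eq[of "{..0}"]) (auto, metis)
  have F_right: "F x = F 1" if "x \<ge> 1" for x
    using that F b_zero by (intro zero_derivative_imp_eq[of "{1..}"]) (auto, metis)
  have "F 0 < F 1"
    using F b_pos by (intro DERIV_pos_imp_increasing_open[of 0 1 F])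
      (auto intro: DERIV_continuous_on has_field_derivative_at_within)
  define S where "S x = (F x - F 0) / (F 1 - F 0)" for x
  define \<rho> where "\<rho> x = b x / (F 1 - F 0)" for x
  have S: "(S has_real_derivative \<rho> x) (at x)" for x
    unfolding S_def[abs_def] \<rho>_def
    using DERIV_cdivide[OF DERIV_diff[OF F[of x] DERIV_const[of "F 0"]], of "F 1 - F 0"]
    by (simp only: diff_0_right)
  have \<rho>: "smooth \<rho>" unfolding \<rho>_def[abs_def] by (intro smooth_divide_const b)
  have smooth_S: "smooth S" by (rule smooth_antiderivative[OF S \<rho>])
  obtain G where G: "\<And>x. (G has_real_derivative S x) (at x)"
    using ex_antiderivative[OF smooth_continuous_on[OF smooth_S]] by blast
  have S_left: "S x = 0" if "x \<le> 0" for x using F_left[OF that] by (simp add: S_def)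
  have S_right: "S x = 1" if "x \<ge> 1" for x
    unfolding S_def F_right[OF that] using \<open>F 0 < F 1\<close> by (metis diff_gt_0_iff_gt divide_self_if less_irrefl)
  have \<rho>_nonneg: "\<rho> x \<ge> 0" for x using b_nonneg \<open>F 0 < F 1\<close> by (simp add: \<rho>_def)
  have mono_S: "mono S"
  proof (rule monoI)
    fix u v :: real assume "u \<le> v"
    then show "S u \<le> S v"
    proof (rule DERIV_nonneg_imp_nondecreasing)
      fix t show "\<exists>y. (S has_real_derivative y) (at t) \<and> 0 \<le> y"
        using S[of t] \<rho>_nonneg[of t] by blast
    qed
  qed
  define R where "R x = G x - G 0" for x
  have R: "(R has_real_derivative S x) (at x)" for x
    unfolding R_def[abs_def] by (auto intro!: derivative_eq_intros G)
  show thesis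
  proof (rule that[OF smooth_antiderivative[OF R smooth_S] smooth_S \<rho> R S])
    show "\<rho> x \<ge> 0" for x by (rule \<rho>_nonneg)
    show "mono S" by (rule mono_S)
    show "S x \<in> {0..1}" for x
      using monoD[OF mono_S, of "min x 0" x] monoD[OF mono_S, of x "max x 1"]
        S_left[of "min x 0"] S_right[of "max x 1"] by simp
    show "\<rho> x = 0" if "x \<notin> {0..1}" for x using b_zero[of x] that by (auto simp: \<rho>_def)
    show "S x = 0" if "x \<le> 0" for x using S_left[OF that] .
    show "S x = 1" if "x \<ge> 1" for x using S_right[OF that] .
    show "R x = 0" if "x \<le> 0" for x
    proof -
      have "(G has_real_derivative 0) (at t)" if "t \<le> 0" for t using G[of t] S_left[OF that] by simp
      then have "G x = G 0" using that by (intro zero_derivative_imp_eq[of "{..0}"]) auto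
      then show ?thesis by (simp add: R_def)
    qed
    show "R x = x - (1 - R 1)" if "x \<ge> 1" for x
    proof -
      have "((\<lambda>t. R t - t) has_real_derivative 0) (at t)" if "t \<ge> 1" for t
        using DERIV_diff[OF R[of t] DERIV_ident] S_right[OF that] by simp
      then have "R x - x = R 1 - 1" using that by (intro zero_derivative_imp_eq[of "{1..}"]) auto
      then show ?thesis by simp
    qed
  qed
qed

section \<open>The second-derivative measure is well defined\<close>

lemma smooth_borel_measurable: "smooth f \<Longrightarrow> f \<in> borel_measurable borel"
  by (intro borel_measurable_continuous_onI smooth_continuous_on)

text \<open>
  Differences of two shifted smooth steps are Schwartz functions that converge boundedly to the indicator
  of a half-open interval, so the values on such intervals are determined.
\<close>
lemma is_distr_measure_unique:
  assumes \<mu>: "is_distr_measure T \<mu>" and \<nu>: "is_distr_measure T \<nu>"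
  shows "\<mu> = \<nu>"
proof (rule signed_measure_eqI)
  show sm: "signed_measure \<mu>" "signed_measure \<nu>"
    using \<mu> \<nu> by (auto simp: is_distr_measure_def)
  fix a b :: real assume "a < b"
  obtain S :: "real \<Rightarrow> real" where S: "smooth S" "\<And>x. S x \<in> {0..1}"
      "\<And>x. x \<le> 0 \<Longrightarrow> S x = 0" "\<And>x. x \<ge> 1 \<Longrightarrow> S x = 1"
    by (rule ex_smooth_ramp) (rule that, assumption+)
  define \<phi> where "\<phi> n t = S (real (Suc n) * t + - real (Suc n) * a) - S (real (Suc n) * t + - real (Suc n) * b)" for n t
  have \<phi>_smooth: "smooth (\<phi> n)" for n
    unfolding \<phi>_def[abs_def] by (intro smooth_diff smooth_affine S)
  have \<phi>_eq: "\<phi> n t = S (real (Suc n) * (t - a)) - S (real (Suc n) * (t - b))" for n t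
    by (simp add: \<phi>_def algebra_simps)
  have one: "S (real (Suc n) * u) = 1" if "u \<ge> 1" for n u
    using that mult_mono[of 1 "real (Suc n)" 1 u] by (intro S(4)) simp
  have zero: "S (real (Suc n) * u) = 0" if "u \<le> 0" for n u
    using that by (intro S(3) mult_nonneg_nonpos) auto
  have \<phi>_schwartz: "\<phi> n \<in> schwartz" for n
  proof (rule schwartz_compact_support[OF \<phi>_smooth])
    fix t assume "t \<notin> {a..b + 1}"
    then consider "t < a" | "t > b + 1" by force
    then show "\<phi> n t = 0"
    proof cases
      case 1
      then show ?thesis
        using \<open>a < b\<close> zero[of "t - a" n] zero[of "t - b" n] unfolding \<phi>_eq by simp
    next
      case 2
      then show ?thesis
        using \<open>a < b\<close> one[of "t - a" n] one[of "t - b" n] unfolding \<phi>_eq by simp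
    qed
  qed
  have S_lim: "(\<lambda>n. S (real (Suc n) * u)) \<longlonglongrightarrow> indicator {0<..} u" for u
  proof (cases "u > 0")
    case True
    obtain N where N: "1 / u \<le> real N" using real_arch_simple by blast
    have "S (real (Suc n) * u) = 1" if "n \<ge> N" for n
    proof (rule S(4))
      have "1 / u \<le> real (Suc n)" using N that by simp
      then show "1 \<le> real (Suc n) * u" using True by (simp only: pos_divide_le_eq)
    qed
    then have "\<forall>\<^sub>F n in sequentially. S (real (Suc n) * u) = 1"
      by (auto simp: eventually_sequentially)
    then show ?thesis using True by (simp add: tendsto_eventually)
  next
    case False
    then show ?thesis using zero[of u] by (simp del: of_nat_Suc)
  qed
  have \<phi>_lim: "(\<lambda>n. \<phi> n t) \<longlonglongrightarrow> indicator {a<..b} t" for t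
  proof -
    have "indicator {a<..b} t = indicator {0<..} (t - a) - (indicator {0<..} (t - b) :: real)"
      using \<open>a < b\<close> by (auto simp: indicator_def)
    then show ?thesis using tendsto_diff[OF S_lim[of "t - a"] S_lim[of "t - b"]] by (simp only: \<phi>_eq)
  qed
  have \<phi>_bound: "norm (\<phi> n t) \<le> 1" for n t
    using S(2)[of "real (Suc n) * t + - real (Suc n) * a"] S(2)[of "real (Suc n) * t + - real (Suc n) * b"]
    by (simp add: \<phi>_def abs_le_iff)
  have int_lim: "(\<lambda>n. \<integral>t. \<phi> n t \<partial>upper_variation \<rho>) \<longlonglongrightarrow> measure (upper_variation \<rho>) {a<..b}"
    if "signed_measure \<rho>" for \<rho>
  proof -
    interpret finite_measure "upper_variation \<rho>" by (rule finite_measure_upper_variation[OF that])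
    have "(\<lambda>n. \<integral>t. \<phi> n t \<partial>upper_variation \<rho>) \<longlonglongrightarrow> (\<integral>t. indicator {a<..b} t \<partial>upper_variation \<rho>)"
      using smooth_borel_measurable[OF \<phi>_smooth] \<phi>_lim \<phi>_bound
      by (intro integral_dominated_convergence[where w = "\<lambda>_. 1"]) (auto cong: measurable_cong_sets)
    then show ?thesis by simp
  qed
  have lim: "(\<lambda>n. signed_integral \<rho> (\<phi> n)) \<longlonglongrightarrow> \<rho> {a<..b}" if "signed_measure \<rho>" for \<rho>
    unfolding signed_integral_def
    using tendsto_diff[OF int_lim[OF that] int_lim[OF signed_measure_uminus[OF that]]]
      signed_measure_eq_upper_minus_lower[OF that]
    by (simp add: lower_variation_def)
  have "signed_integral \<mu> (\<phi> n) = signed_integral \<nu> (\<phi> n)" for n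
    using \<mu> \<nu> \<phi>_schwartz[of n] by (simp add: is_distr_measure_def)
  then show "\<mu> {a<..b} = \<nu> {a<..b}"
    using lim[OF sm(1)] lim[OF sm(2)] by (simp add: LIMSEQ_unique)
qed

lemma D2_measure_eqI:
  "is_distr_measure (distr_D2 (distr_of_fun f)) \<mu> \<Longrightarrow> D2_measure f = \<mu>"
  unfolding D2_measure_def using is_distr_measure_unique by blast

lemma is_distr_measure_D2_measure:
  assumes "f \<in> BV2"
  shows "is_distr_measure (distr_D2 (distr_of_fun f)) (D2_measure f)"
proof -
  obtain \<mu> where "is_distr_measure (distr_D2 (distr_of_fun f)) \<mu>"
    using assms by (auto simp: BV2_def BV2_distr_def)
  then show ?thesis using D2_measure_eqI by metis
qed

section \<open>Kinks of a function bound its second variation from below\<close>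

definition slope :: "(nat \<Rightarrow> real) \<Rightarrow> (nat \<Rightarrow> real) \<Rightarrow> nat \<Rightarrow> real" where
  "slope x v i = (v (Suc i) - v i) / (x (Suc i) - x i)"

definition kink :: "(nat \<Rightarrow> real) \<Rightarrow> (nat \<Rightarrow> real) \<Rightarrow> nat \<Rightarrow> real" where
  "kink x v i = slope x v i - slope x v (i - 1)"

lemma kink_cmult: "kink x (\<lambda>j. c * v j) i = c * kink x v i"
  by (simp add: kink_def slope_def right_diff_distrib diff_divide_distrib)

lemma kink_has_derivative:
  assumes "\<And>j. ((\<lambda>t. v t j) has_real_derivative w j) (at t)"
  shows "((\<lambda>t. kink x (v t) i) has_real_derivative kink x w i) (at t)"
  unfolding kink_def slope_def by (intro DERIV_diff DERIV_cdivide assms)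

lemma kink_has_bochner_integral:
  fixes v :: "'a \<Rightarrow> nat \<Rightarrow> real"
  assumes "\<And>j. has_bochner_integral N (\<lambda>t. v t j) (w j)"
  shows "has_bochner_integral N (\<lambda>t. kink x (v t) i) (kink x w i)"
  unfolding kink_def slope_def by (intro has_bochner_integral_diff has_bochner_integral_divide_zero assms)

lemma kink_tendsto:
  assumes "\<And>j. ((\<lambda>n. v n j) \<longlongrightarrow> w j) F"
  shows "((\<lambda>n. kink x (v n) i) \<longlongrightarrow> kink x w i) F"
  unfolding kink_def slope_def divide_inverse by (intro tendsto_intros assms)

lemma smooth_kink:
  assumes "\<And>j. smooth (\<lambda>t. v t j)"
  shows "smooth (\<lambda>t. kink x (v t) i)"
  unfolding kink_def slope_def by (intro smooth_diff smooth_divide_const assms)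

lemma kink_affine_eq_0:
  assumes "strict_mono_on {1..M} x" "i \<in> {2..M - 1}" "\<And>j. j \<in> {1..M} \<Longrightarrow> v j = \<alpha> * x j + \<beta>"
  shows "kink x v i = 0"
proof -
  have s: "slope x v j = \<alpha>" if "j \<in> {1..<M}" for j
  proof -
    have "x j < x (Suc j)" using that by (intro strict_mono_onD[OF assms(1)]) auto
    then show ?thesis using that by (simp add: slope_def assms(3) flip: right_diff_distrib)
  qed
  show ?thesis unfolding kink_def using assms(2) by (subst (1 2) s) auto
qed

text \<open>
  Convexity: all kinks of a convex function are nonnegative, so that their absolute values telescope to the
  difference between the last and the first slope; by the mean value theorem the slopes are values of the derivative.
\<close>
lemma sum_kink_mono_slopes:
  assumes x: "strict_mono_on {1..M} x" and "2 \<le> M"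
    and g: "\<And>z. (g has_real_derivative g' z) (at z)" "mono g'"
  shows "(\<Sum>i = 2..M - 1. \<bar>kink x (\<lambda>j. g (x j)) i\<bar>) \<le> g' (x M) - g' (x 1)"
proof -
  have "\<exists>z\<ge>x i. z \<le> x (Suc i) \<and> slope x (\<lambda>j. g (x j)) i = g' z" if "i \<in> {1..<M}" for i
  proof -
    have "x i < x (Suc i)" using that by (intro strict_mono_onD[OF x]) auto
    then obtain z where "z > x i" "z < x (Suc i)" "g (x (Suc i)) - g (x i) = (x (Suc i) - x i) * g' z"
      using MVT2[of "x i" "x (Suc i)" g g'] g(1) by auto
    then show ?thesis using \<open>x i < x (Suc i)\<close> by (auto simp: slope_def intro!: exI[of _ z])
  qed
  then obtain z where z: "\<And>i. i \<in> {1..<M} \<Longrightarrow> x i \<le> z i \<and> z i \<le> x (Suc i) \<and> slope x (\<lambda>j. g (x j)) i = g' (z i)"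
    by metis
  have "\<bar>kink x (\<lambda>j. g (x j)) i\<bar> = slope x (\<lambda>j. g (x j)) i - slope x (\<lambda>j. g (x j)) (i - 1)"
    if "i \<in> {2..M - 1}" for i
  proof -
    have i: "i \<in> {1..<M}" "i - 1 \<in> {1..<M}" "Suc (i - 1) = i" using that by auto
    then have "z (i - 1) \<le> z i" using z[of i] z[of "i - 1"] by fastforce
    then have "g' (z (i - 1)) \<le> g' (z i)" by (rule monoD[OF g(2)])
    then show ?thesis using z[OF i(1)] z[OF i(2)] by (simp add: kink_def)
  qed
  then have "(\<Sum>i = 2..M - 1. \<bar>kink x (\<lambda>j. g (x j)) i\<bar>) =
      (\<Sum>i = Suc 1..M - 1. slope x (\<lambda>j. g (x j)) i - slope x (\<lambda>j. g (x j)) (i - 1))"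
    by (simp add: numeral_2_eq_2)
  also have "\<dots> = g' (z (M - 1)) - g' (z 1)"
    using \<open>2 \<le> M\<close> z[of 1] z[of "M - 1"] by (subst sum_telescope'') auto
  also have "\<dots> \<le> g' (x M) - g' (x 1)"
    using \<open>2 \<le> M\<close> z[of 1] z[of "M - 1"] monoD[OF g(2)] by (intro diff_mono) auto
  finally show ?thesis .
qed

text \<open>
  Substituting \<open>t = z + u / (n + 1)\<close> turns the integral into a weighted average of \<open>f\<close> over the interval from \<open>z\<close> to
  \<open>z + 1 / (n + 1)\<close>.
\<close>
lemma mollifier_limit:
  fixes f \<rho> S :: "real \<Rightarrow> real"
  assumes f: "continuous_on UNIV f" and \<rho>: "continuous_on UNIV \<rho>"
    and S: "\<And>x. (S has_real_derivative \<rho> x) (at x)" "S 1 - S 0 = 1"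
    and \<rho>_nonneg: "\<And>x. \<rho> x \<ge> 0" and supp: "\<And>x. x \<notin> {0..1} \<Longrightarrow> \<rho> x = 0"
  shows "integrable lborel (\<lambda>t. f t * (real (Suc n) * \<rho> (real (Suc n) * (t - z))))"
    and "(\<lambda>n. \<integral>t. f t * (real (Suc n) * \<rho> (real (Suc n) * (t - z))) \<partial>lborel) \<longlonglongrightarrow> f z"
proof -
  have int: "integrable lborel g" if g: "continuous_on UNIV g" "\<And>t. t \<notin> {c..d} \<Longrightarrow> g t = 0" for c d and g :: "real \<Rightarrow> real"
  proof -
    have "set_integrable lborel {c..d} g"
      using g(1) by (intro borel_integrable_atLeastAtMost') (rule continuous_on_subset, auto)
    moreover have "(\<lambda>t. indicator {c..d} t *\<^sub>R g t) = g" using g(2) by (auto simp: indicator_def fun_eq_iff)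
    ultimately show ?thesis by (simp add: set_integrable_def)
  qed
  show "integrable lborel (\<lambda>t. f t * (real (Suc n) * \<rho> (real (Suc n) * (t - z))))" for n
  proof (rule int)
    show "continuous_on UNIV (\<lambda>t. f t * (real (Suc n) * \<rho> (real (Suc n) * (t - z))))"
      by (intro continuous_intros f continuous_on_compose2[OF \<rho>]) auto
    fix t assume "t \<notin> {z..z + 1}"
    then consider "t - z < 0" | "t - z > 1" by force
    then have "real (Suc n) * (t - z) < 0 \<or> real (Suc n) * (t - z) > 1"
    proof cases
      case 2
      then have "1 * 1 < real (Suc n) * (t - z)" by (intro mult_le_less_imp_less) auto
      then show ?thesis by simp
    qed (simp add: mult_pos_neg)
    then have "real (Suc n) * (t - z) \<notin> {0..1}" by auto
    then have "\<rho> (real (Suc n) * (t - z)) = 0" by (rule supp)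
    then show "f t * (real (Suc n) * \<rho> (real (Suc n) * (t - z))) = 0" by (simp only: mult_zero_right)
  qed
  have \<rho>_int: "integrable lborel \<rho>" by (rule int[OF \<rho> supp])
  have "(\<integral>u. \<rho> u \<partial>lborel) = (\<integral>u. indicator {0..1} u *\<^sub>R \<rho> u \<partial>lborel)"
    using supp by (intro Bochner_Integration.integral_cong) (auto simp: indicator_def)
  also have "\<dots> = S 1 - S 0"
    using S(1) \<rho> by (intro integral_FTC_atLeastAtMost)
      (auto simp: has_real_derivative_iff_has_vector_derivative[symmetric] intro: has_field_derivative_at_within continuous_on_subset)
  finally have \<rho>_1: "(\<integral>u. \<rho> u \<partial>lborel) = 1" using S(2) by simp
  have eq: "(\<integral>t. f t * (real (Suc n) * \<rho> (real (Suc n) * (t - z))) \<partial>lborel) =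
      (\<integral>u. f (z + u / real (Suc n)) * \<rho> u \<partial>lborel)" for n
    using lborel_integral_real_affine[of "1 / real (Suc n)" "\<lambda>t. f t * (real (Suc n) * \<rho> (real (Suc n) * (t - z)))" z]
    by (simp flip: integral_mult_right_zero)
  have "compact (f ` {z..z+1})"
    using f by (intro compact_continuous_image) (auto intro: continuous_on_subset)
  then obtain B where B: "\<And>t. t \<in> {z..z+1} \<Longrightarrow> \<bar>f t\<bar> \<le> B"
    using compact_imp_bounded bounded_iff by (metis imageI real_norm_def)
  have "(\<lambda>n. \<integral>u. f (z + u / real (Suc n)) * \<rho> u \<partial>lborel) \<longlonglongrightarrow> (\<integral>u. f z * \<rho> u \<partial>lborel)"
  proof (rule integral_dominated_convergence[where w = "\<lambda>u. B * \<rho> u"])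
    show "AE u in lborel. (\<lambda>n. f (z + u / real (Suc n)) * \<rho> u) \<longlonglongrightarrow> f z * \<rho> u"
    proof (intro AE_I2 tendsto_mult tendsto_const)
      fix u :: real
      have "(\<lambda>n. u / real (Suc n)) \<longlonglongrightarrow> 0"
        using LIMSEQ_ignore_initial_segment[OF lim_const_over_n[of u], of 1] by simp
      then have "(\<lambda>n. z + u / real (Suc n)) \<longlonglongrightarrow> z" using tendsto_add[OF tendsto_const] by fastforce
      then show "(\<lambda>n. f (z + u / real (Suc n))) \<longlonglongrightarrow> f z"
        using f by (intro isCont_tendsto_compose[of z f]) (auto simp: continuous_on_eq_continuous_at)
    qed
    show "AE u in lborel. norm (f (z + u / real (Suc n)) * \<rho> u) \<le> B * \<rho> u" for n
    proof (intro AE_I2)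
      fix u :: real
      show "norm (f (z + u / real (Suc n)) * \<rho> u) \<le> B * \<rho> u"
      proof (cases "u \<in> {0..1}")
        case True
        have "u / real (Suc n) \<le> 1 / 1" using True by (intro frac_le) auto
        then have "\<bar>f (z + u / real (Suc n))\<bar> \<le> B" using True by (intro B) simp
        then show ?thesis using \<rho>_nonneg[of u] by (auto simp: abs_mult intro: mult_right_mono)
      qed (simp add: supp)
    qed
    show "(\<lambda>u. f (z + u / real (Suc n)) * \<rho> u) \<in> borel_measurable lborel" for n
      using borel_measurable_continuous_onI[OF f] borel_measurable_continuous_onI[OF \<rho>] by measurable
  qed (use \<rho>_int borel_measurable_continuous_onI[OF \<rho>] in auto)
  then show "(\<lambda>n. \<integral>t. f t * (real (Suc n) * \<rho> (real (Suc n) * (t - z))) \<partial>lborel) \<longlonglongrightarrow> f z"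
    by (simp only: eq) (simp add: \<rho>_1)
qed

text \<open>
  The test function \<open>\<phi> k\<close> is the combination, with weights \<open>sgn\<close> of the kinks of \<open>f\<close>, of smoothed hat functions:
  the kink, taken with respect to the node position \<open>z\<close>, of the ramp \<open>R (k * (t - z)) / k\<close>.  This ramp is convex in \<open>z\<close>
  with slopes in \<open>[-1, 0]\<close>, so the smoothed hats are nonnegative with sum at most \<open>1\<close>; therefore \<open>\<bar>\<phi> k\<bar> \<le> 1\<close> exactly,
  not just in the limit.  The kinks of affine functions vanish, which gives compact support.
\<close>
lemma sum_kinks_le_tv_norm:
  assumes f: "f \<in> BV2" and x: "strict_mono_on {1..M} x" and "2 \<le> M"
  shows "(\<Sum>i = 2..M - 1. \<bar>kink x (\<lambda>j. f (x j)) i\<bar>) \<le> tv_norm (D2_measure f)"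
proof -
  have cont_f: "continuous_on UNIV f" using f by (simp add: BV2_def)
  obtain R S \<rho> :: "real \<Rightarrow> real" and c where ramp:
    "smooth R" "smooth S" "smooth \<rho>"
    "\<And>x. (R has_real_derivative S x) (at x)" "\<And>x. (S has_real_derivative \<rho> x) (at x)"
    "\<And>x. \<rho> x \<ge> 0" "\<And>x. x \<notin> {0..1} \<Longrightarrow> \<rho> x = 0"
    "mono S" "\<And>x. S x \<in> {0..1}"
    "\<And>x. x \<le> 0 \<Longrightarrow> S x = 0" "\<And>x. x \<ge> 1 \<Longrightarrow> S x = 1"
    "\<And>x. x \<le> 0 \<Longrightarrow> R x = 0" "\<And>x. x \<ge> 1 \<Longrightarrow> R x = x - c"
    by (rule ex_smooth_ramp) (rule that, assumption+)
  define \<sigma> where "\<sigma> i = sgn (kink x (\<lambda>j. f (x j)) i)" for i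
  define \<phi> where "\<phi> k t = (\<Sum>i = 2..M - 1. \<sigma> i * kink x (\<lambda>j. R (k * (t - x j)) / k) i)" for k t
  define \<psi> where "\<psi> k t = (\<Sum>i = 2..M - 1. \<sigma> i * kink x (\<lambda>j. k * \<rho> (k * (t - x j))) i)" for k t
  have x_le: "x 1 \<le> x j" "x j \<le> x M" if "j \<in> {1..M}" for j
    using strict_mono_on_leD[OF x] that by auto
  have bound: "\<bar>\<phi> k t\<bar> \<le> 1" if "k > 0" for k t
  proof -
    have "\<bar>\<phi> k t\<bar> \<le> (\<Sum>i = 2..M - 1. \<bar>\<sigma> i * kink x (\<lambda>j. R (k * (t - x j)) / k) i\<bar>)"
      unfolding \<phi>_def by (rule sum_abs)
    also have "\<dots> \<le> (\<Sum>i = 2..M - 1. \<bar>kink x (\<lambda>j. R (k * (t - x j)) / k) i\<bar>)"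
      by (intro sum_mono) (simp add: \<sigma>_def abs_mult abs_sgn_eq)
    also have "\<dots> \<le> - S (k * (t - x M)) - - S (k * (t - x 1))"
    proof (rule sum_kink_mono_slopes[OF x \<open>2 \<le> M\<close>, where g = "\<lambda>z. R (k * (t - z)) / k" and g' = "\<lambda>z. - S (k * (t - z))"])
      show "((\<lambda>z. R (k * (t - z)) / k) has_real_derivative - S (k * (t - z))) (at z)" for z
        using that by (auto intro!: derivative_eq_intros DERIV_chain2[OF ramp(4)])
      show "mono (\<lambda>z. - S (k * (t - z)))"
        using that by (auto intro!: monoI monoD[OF ramp(8)] mult_left_mono)
    qed
    also have "\<dots> \<le> 1" using ramp(9)[of "k * (t - x M)"] ramp(9)[of "k * (t - x 1)"] by simp
    finally show ?thesis .
  qed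
  have smooth_\<phi>: "smooth (\<phi> k)" for k
  proof -
    have "smooth (\<lambda>t. R (k * (t - x j)))" for j
      using smooth_affine[OF ramp(1), of k "- (k * x j)"] by (simp add: right_diff_distrib)
    then show ?thesis
      unfolding \<phi>_def[abs_def]
      by (intro smooth_sum smooth_mult smooth_const smooth_kink smooth_divide_const)
  qed
  have deriv_\<phi>: "deriv (deriv (\<phi> k)) = \<psi> k" if "k > 0" for k
  proof -
    have S': "((\<lambda>t. S (k * (t - x j))) has_real_derivative k * \<rho> (k * (t - x j))) (at t)" for t j
    proof -
      have "((\<lambda>t. k * (t - x j)) has_real_derivative k) (at t)"
        by (auto intro!: derivative_eq_intros)
      from DERIV_chain2[OF ramp(5) this] show ?thesis by (simp only: mult.commute)
    qed
    have 1: "(\<phi> k has_real_derivative (\<Sum>i = 2..M - 1. \<sigma> i * kink x (\<lambda>j. S (k * (t - x j))) i)) (at t)" for t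
      unfolding \<phi>_def[abs_def] using that
      by (intro DERIV_sum DERIV_cmult kink_has_derivative)
        (auto intro!: derivative_eq_intros DERIV_chain2[OF ramp(4)])
    have 2: "((\<lambda>t. \<Sum>i = 2..M - 1. \<sigma> i * kink x (\<lambda>j. S (k * (t - x j))) i) has_real_derivative \<psi> k t) (at t)" for t
      unfolding \<psi>_def
      by (intro DERIV_sum DERIV_cmult kink_has_derivative S')
    have "deriv (\<phi> k) = (\<lambda>t. \<Sum>i = 2..M - 1. \<sigma> i * kink x (\<lambda>j. S (k * (t - x j))) i)"
      using 1 by (intro ext DERIV_imp_deriv)
    then show ?thesis using 2 by (auto intro!: ext DERIV_imp_deriv)
  qed
  have schwartz_\<phi>: "\<phi> k \<in> schwartz" if "k \<ge> 1" for k
  proof (rule schwartz_compact_support[OF smooth_\<phi>])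
    fix t assume "t \<notin> {x 1..x M + 1}"
    then consider "t < x 1" | "t > x M + 1" by force
    then have "\<exists>\<alpha> \<beta>. \<forall>j\<in>{1..M}. R (k * (t - x j)) / k = \<alpha> * x j + \<beta>"
    proof cases
      case 1
      have "R (k * (t - x j)) / k = 0 * x j + 0" if j: "j \<in> {1..M}" for j
        using 1 x_le(1)[OF j] \<open>k \<ge> 1\<close> by (subst ramp(12)) (auto intro: mult_nonneg_nonpos)
      then show ?thesis by blast
    next
      case 2
      \<comment> \<open>to the right of the data all ramps have passed their transition zone and are affine in the node\<close>
      have "R (k * (t - x j)) / k = (- 1) * x j + (t - c / k)" if j: "j \<in> {1..M}" for j
      proof -
        have "1 * 1 \<le> k * (t - x j)" using 2 x_le(2)[OF j] \<open>k \<ge> 1\<close> by (intro mult_mono) auto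
        then show ?thesis using \<open>k \<ge> 1\<close> by (subst ramp(13)) (auto simp: field_simps)
      qed
      then show ?thesis by blast
    qed
    then obtain \<alpha> \<beta> where "\<And>j. j \<in> {1..M} \<Longrightarrow> R (k * (t - x j)) / k = \<alpha> * x j + \<beta>" by blast
    then have "kink x (\<lambda>j. R (k * (t - x j)) / k) i = 0" if "i \<in> {2..M - 1}" for i
      using kink_affine_eq_0[OF x that, of "\<lambda>j. R (k * (t - x j)) / k"] by blast
    then show "\<phi> k t = 0" by (simp add: \<phi>_def)
  qed
  note moll = mollifier_limit[OF cont_f smooth_continuous_on[OF ramp(3)] ramp(5) _ ramp(6,7)]
  have S01: "S 1 - S 0 = 1" using ramp(10)[of 0] ramp(11)[of 1] by simp
  define I where "I n z = (\<integral>t. f t * (real (Suc n) * \<rho> (real (Suc n) * (t - z))) \<partial>lborel)" for n z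
  have int_\<psi>: "(\<integral>t. f t * \<psi> (real (Suc n)) t \<partial>lborel) = (\<Sum>i = 2..M - 1. \<sigma> i * kink x (\<lambda>j. I n (x j)) i)" for n
  proof (rule has_bochner_integral_integral_eq)
    have "has_bochner_integral lborel (\<lambda>t. \<Sum>i = 2..M - 1. \<sigma> i * kink x (\<lambda>j. f t * (real (Suc n) * \<rho> (real (Suc n) * (t - x j)))) i)
       (\<Sum>i = 2..M - 1. \<sigma> i * kink x (\<lambda>j. I n (x j)) i)"
      unfolding I_def
      by (intro has_bochner_integral_sum has_bochner_integral_mult_right kink_has_bochner_integral
          has_bochner_integral_integrable moll(1) S01)
    then show "has_bochner_integral lborel (\<lambda>t. f t * \<psi> (real (Suc n)) t) (\<Sum>i = 2..M - 1. \<sigma> i * kink x (\<lambda>j. I n (x j)) i)"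
      by (simp only: kink_cmult \<psi>_def sum_distrib_left mult.left_commute)
  qed
  have le: "(\<Sum>i = 2..M - 1. \<sigma> i * kink x (\<lambda>j. I n (x j)) i) \<le> tv_norm (D2_measure f)" for n
  proof -
    note D2 = is_distr_measure_D2_measure[OF f]
    have "(\<Sum>i = 2..M - 1. \<sigma> i * kink x (\<lambda>j. I n (x j)) i) = distr_D2 (distr_of_fun f) (\<phi> (real (Suc n)))"
      by (simp only: distr_D2_def distr_of_fun_def deriv_\<phi> int_\<psi> of_nat_0_less_iff zero_less_Suc)
    also have "\<dots> = signed_integral (D2_measure f) (\<phi> (real (Suc n)))"
      using D2 schwartz_\<phi>[of "real (Suc n)"] unfolding is_distr_measure_def by simp
    also have "\<dots> \<le> tv_norm (D2_measure f)"
      using abs_signed_integral_le_tv_norm[of "D2_measure f" "\<phi> (real (Suc n))"] D2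
        smooth_borel_measurable[OF smooth_\<phi>] bound unfolding is_distr_measure_def by fastforce
    finally show ?thesis .
  qed
  have "(\<lambda>n. \<Sum>i = 2..M - 1. \<sigma> i * kink x (\<lambda>j. I n (x j)) i) \<longlonglongrightarrow> (\<Sum>i = 2..M - 1. \<sigma> i * kink x (\<lambda>j. f (x j)) i)"
    unfolding I_def by (intro tendsto_sum tendsto_mult tendsto_const kink_tendsto moll(2) S01)
  then have "(\<Sum>i = 2..M - 1. \<sigma> i * kink x (\<lambda>j. f (x j)) i) \<le> tv_norm (D2_measure f)"
    by (rule LIMSEQ_le_const2) (use le in blast)
  then show ?thesis by (simp add: \<sigma>_def abs_sgn mult.commute)
qed

section \<open>Atomic measures\<close>

definition atomic_measure :: "'i set \<Rightarrow> ('i \<Rightarrow> real) \<Rightarrow> ('i \<Rightarrow> real) \<Rightarrow> real set \<Rightarrow> real" where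
  "atomic_measure I c k A = (if A \<in> sets borel then \<Sum>i\<in>I. c i * indicator A (k i) else 0)"

lemma atomic_measure_uminus: "(\<lambda>A. - atomic_measure I c k A) = atomic_measure I (\<lambda>i. - c i) k"
  by (auto simp: atomic_measure_def fun_eq_iff sum_negf)

lemma indicator_sums_disjoint:
  assumes "disjoint_family A"
  shows "(\<lambda>n. indicator (A n) x :: real) sums indicator (\<Union>n. A n) x"
proof (cases "x \<in> (\<Union>n. A n)")
  case True
  then obtain m where m: "x \<in> A m" by blast
  then have "x \<notin> A n" if "n \<noteq> m" for n
    using disjoint_family_onD[OF assms, of m n] that by auto
  then have "(\<lambda>n. indicator (A n) x) = (\<lambda>n. if n = m then 1 else 0 :: real)"
    using m by (auto simp: fun_eq_iff)
  then show ?thesis using True sums_single[of m "\<lambda>_. 1 :: real"] by simp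
qed auto

lemma signed_measure_atomic_measure: "signed_measure (atomic_measure I c k)"
proof -
  have "(\<lambda>n. \<Sum>i\<in>I. c i * indicator (A n) (k i)) sums (\<Sum>i\<in>I. c i * indicator (\<Union>n. A n) (k i))"
    if "disjoint_family A" for A :: "nat \<Rightarrow> real set"
    by (intro sums_sum sums_mult indicator_sums_disjoint that)
  moreover have "(\<Union>n. A n) \<in> sets borel" if "range A \<subseteq> sets borel" for A :: "nat \<Rightarrow> real set"
    using that by auto
  ultimately show ?thesis
    unfolding signed_measure_def by (auto simp: atomic_measure_def range_subsetD)
qed

text \<open>
  The supremum over \<open>B \<subseteq> A\<close> is attained by the finite set of the atoms in \<open>A\<close> with positive weight.  Negative weights
  are suppressed on the right-hand side because \<open>ennreal\<close> truncates them.
\<close>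
lemma upper_variation_atomic_measure:
  assumes "finite I" "inj_on k I"
  shows "upper_variation (atomic_measure I c k) = distr (point_measure I (\<lambda>i. ennreal (c i))) borel k"
proof (rule measure_eqI)
  fix A assume "A \<in> sets (upper_variation (atomic_measure I c k))"
  then have A: "A \<in> sets borel" by simp
  let ?J = "{i \<in> I. k i \<in> A}"
  have "emeasure (distr (point_measure I (\<lambda>i. ennreal (c i))) borel k) A = (\<Sum>i\<in>?J. ennreal (c i))"
    using assms A by (subst emeasure_distr)
      (auto simp: space_point_measure emeasure_point_measure_finite vimage_def Int_def conj_commute)
  also have "\<dots> = (\<Sum>i\<in>?J. ennreal (max 0 (c i)))"
    by (intro sum.cong) (auto simp: max_def ennreal_neg)
  also have "\<dots> = ennreal (\<Sum>i\<in>?J. max 0 (c i))" by (rule sum_ennreal) simp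
  also have "\<dots> = (SUP B\<in>{B \<in> sets borel. B \<subseteq> A}. ennreal (atomic_measure I c k B))"
  proof (rule antisym)
    \<comment> \<open>the positive part of the atoms in \<open>A\<close>\<close>
    let ?B = "k ` {i \<in> ?J. c i > 0}"
    have B: "?B \<in> sets borel" "?B \<subseteq> A"
      using assms(1) by (auto intro!: borel_closed finite_imp_closed)
    have "indicator ?B (k i) = (if i \<in> ?J \<and> c i > 0 then 1 else 0 :: real)" if "i \<in> I" for i
      using that inj_onD[OF assms(2)] by (auto simp: indicator_def)
    then have "atomic_measure I c k ?B = (\<Sum>i\<in>I. if i \<in> ?J then max 0 (c i) else 0)"
      using B by (auto simp: atomic_measure_def intro!: sum.cong)
    also have "\<dots> = (\<Sum>i\<in>?J. max 0 (c i))"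
      using assms(1) by (intro sum.mono_neutral_cong_right) auto
    finally show "ennreal (\<Sum>i\<in>?J. max 0 (c i)) \<le> (SUP B\<in>{B \<in> sets borel. B \<subseteq> A}. ennreal (atomic_measure I c k B))"
      using B by (intro SUP_upper2[of ?B]) auto
    show "(SUP B\<in>{B \<in> sets borel. B \<subseteq> A}. ennreal (atomic_measure I c k B)) \<le> ennreal (\<Sum>i\<in>?J. max 0 (c i))"
    proof (rule SUP_least, clarify)
      fix B assume B: "B \<in> sets borel" "B \<subseteq> A"
      have "atomic_measure I c k B \<le> (\<Sum>i\<in>I. if i \<in> ?J then max 0 (c i) else 0)"
        unfolding atomic_measure_def using B by (auto simp: indicator_def intro!: sum_mono)
      also have "\<dots> = (\<Sum>i\<in>?J. max 0 (c i))"
        using assms(1) by (intro sum.mono_neutral_cong_right) auto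
      finally show "ennreal (atomic_measure I c k B) \<le> ennreal (\<Sum>i\<in>?J. max 0 (c i))"
        by (rule ennreal_leI)
    qed
  qed
  also have "\<dots> = emeasure (upper_variation (atomic_measure I c k)) A"
    by (rule emeasure_upper_variation[OF signed_measure_atomic_measure A, symmetric])
  finally show "emeasure (upper_variation (atomic_measure I c k)) A =
      emeasure (distr (point_measure I (\<lambda>i. ennreal (c i))) borel k) A" ..
qed simp

lemma integral_upper_variation_atomic_measure:
  assumes "finite I" "inj_on k I" "\<phi> \<in> borel_measurable borel"
  shows "(\<integral>t. \<phi> t \<partial>upper_variation (atomic_measure I c k)) = (\<Sum>i\<in>I. max 0 (c i) * \<phi> (k i))"
proof -
  have "point_measure I (\<lambda>i. ennreal (c i)) = point_measure I (\<lambda>i. ennreal (max 0 (c i)))"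
    by (simp add: max_def ennreal_neg if_distrib cong: if_cong) (metis (mono_tags) ennreal_neg linorder_le_cases)
  then show ?thesis
    unfolding upper_variation_atomic_measure[OF assms(1,2)] using assms
    by (subst integral_distr) (auto simp: lebesgue_integral_point_measure_finite)
qed

lemma measure_upper_variation_atomic_measure:
  assumes "finite I" "inj_on k I"
  shows "measure (upper_variation (atomic_measure I c k)) UNIV = (\<Sum>i\<in>I. max 0 (c i))"
  using integral_upper_variation_atomic_measure[OF assms, of "\<lambda>_. 1" c] by simp

lemma signed_integral_atomic_measure:
  assumes "finite I" "inj_on k I" "\<phi> \<in> borel_measurable borel"
  shows "signed_integral (atomic_measure I c k) \<phi> = (\<Sum>i\<in>I. c i * \<phi> (k i))"
  unfolding signed_integral_def lower_variation_def atomic_measure_uminus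
  using assms by (simp add: integral_upper_variation_atomic_measure flip: sum_subtractf left_diff_distrib)
    (auto intro!: sum.cong simp: max_def)

lemma tv_norm_atomic_measure:
  assumes "finite I" "inj_on k I"
  shows "tv_norm (atomic_measure I c k) = (\<Sum>i\<in>I. \<bar>c i\<bar>)"
  unfolding tv_norm_def lower_variation_def atomic_measure_uminus
  using assms by (simp add: measure_upper_variation_atomic_measure flip: sum.distrib)
    (auto intro!: sum.cong simp: max_def)

section \<open>Linear splines attain the bound\<close>

lemma schwartz_has_derivative:
  "\<phi> \<in> schwartz \<Longrightarrow> (\<phi> has_real_derivative deriv \<phi> x) (at x)"
  unfolding schwartz_def by (metis (mono_tags, lifting) DERIV_deriv_iff_real_differentiable funpow_0 mem_Collect_eq)

lemma schwartz_deriv: "\<phi> \<in> schwartz \<Longrightarrow> deriv \<phi> \<in> schwartz"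
  unfolding schwartz_def
proof (safe, goal_cases)
  case (1 n x)
  then show ?case by (metis funpow_swap1 funpow.simps(2) comp_apply)
next
  case (2 k n)
  then have "bounded (range (\<lambda>x. x ^ k * (deriv ^^ Suc n) \<phi> x))" by blast
  then show ?case by (simp add: funpow_swap1)
qed

lemma schwartz_continuous_on: "\<phi> \<in> schwartz \<Longrightarrow> continuous_on A \<phi>"
  by (rule DERIV_continuous_on) (rule has_field_derivative_at_within[OF schwartz_has_derivative])

lemma schwartz_borel_measurable: "\<phi> \<in> schwartz \<Longrightarrow> \<phi> \<in> borel_measurable borel"
  by (intro borel_measurable_continuous_onI schwartz_continuous_on)

lemma schwartz_le_seminorm:
  assumes "\<phi> \<in> schwartz"
  shows "\<bar>x ^ k * (deriv ^^ n) \<phi> x\<bar> \<le> schwartz_seminorm k n \<phi>"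
proof -
  have "bounded (range (\<lambda>x. x ^ k * (deriv ^^ n) \<phi> x))" using assms by (auto simp: schwartz_def)
  then have "bdd_above (range (\<lambda>x. \<bar>x ^ k * (deriv ^^ n) \<phi> x\<bar>))"
    by (auto simp: bounded_iff bdd_above_def)
  then show ?thesis unfolding schwartz_seminorm_def by (intro cSUP_upper) auto
qed

text \<open>
  Controls \<open>(1 + \<bar>x\<bar>) (1 + x\<^sup>2) \<bar>\<phi> x\<bar>\<close>, which is the sum of \<open>\<bar>x\<bar> ^ k * \<bar>\<phi> x\<bar>\<close> for \<open>k \<le> 3\<close>.  The first factor
  absorbs linear growth, the second one leaves an integrable majorant.
\<close>
definition schwartz_bound :: "(real \<Rightarrow> real) \<Rightarrow> real" where
  "schwartz_bound \<phi> = (\<Sum>k\<le>3. schwartz_seminorm k 0 \<phi>)"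

lemma abs_schwartz_le:
  assumes "\<phi> \<in> schwartz"
  shows "(1 + \<bar>x\<bar>) * \<bar>\<phi> x\<bar> \<le> schwartz_bound \<phi> * inverse (1 + x\<^sup>2)"
proof -
  have "(1 + \<bar>x\<bar>) * \<bar>\<phi> x\<bar> * (1 + x\<^sup>2) = (\<Sum>k\<le>3. \<bar>x ^ k * \<phi> x\<bar>)"
    by (simp add: eval_nat_numeral abs_mult algebra_simps)
  also have "\<dots> \<le> schwartz_bound \<phi>"
    unfolding schwartz_bound_def using schwartz_le_seminorm[OF assms, of _ _ 0] by (intro sum_mono) simp
  finally show ?thesis
    by (simp add: field_simps add_pos_nonneg)
qed

lemma integrable_inverse_1_plus_square_lborel: "integrable lborel (\<lambda>x::real. inverse (1 + x\<^sup>2))"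
  using integrable_inverse_1_plus_square by (simp add: set_integrable_def)

lemma linear_growth_times_schwartz:
  assumes f: "f \<in> borel_measurable borel" "\<And>x. \<bar>f x\<bar> \<le> K * (1 + \<bar>x\<bar>)" and \<phi>: "\<phi> \<in> schwartz"
  shows "integrable lborel (\<lambda>x. f x * \<phi> x)"
    and "\<bar>\<integral>x. f x * \<phi> x \<partial>lborel\<bar> \<le> K * (\<integral>x. inverse (1 + x\<^sup>2) \<partial>lborel) * schwartz_bound \<phi>"
proof -
  have "K \<ge> 0" using f(2)[of 0] by simp
  have le: "\<bar>f x * \<phi> x\<bar> \<le> K * schwartz_bound \<phi> * inverse (1 + x\<^sup>2)" for x
  proof -
    have "\<bar>f x * \<phi> x\<bar> \<le> K * (1 + \<bar>x\<bar>) * \<bar>\<phi> x\<bar>"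
      unfolding abs_mult by (intro mult_right_mono f(2)) auto
    also have "\<dots> \<le> K * (schwartz_bound \<phi> * inverse (1 + x\<^sup>2))"
      unfolding mult.assoc by (intro mult_left_mono abs_schwartz_le \<phi> \<open>K \<ge> 0\<close>)
    finally show ?thesis by simp
  qed
  have int: "integrable lborel (\<lambda>x. K * schwartz_bound \<phi> * inverse (1 + x\<^sup>2))"
    by (intro integrable_mult_right integrable_inverse_1_plus_square_lborel)
  show 1: "integrable lborel (\<lambda>x. f x * \<phi> x)"
    using le f(1) schwartz_borel_measurable[OF \<phi>]
    by (intro Bochner_Integration.integrable_bound[OF int]) (auto intro!: AE_I2 order_trans[OF le] abs_ge_self)
  have "\<bar>\<integral>x. f x * \<phi> x \<partial>lborel\<bar> \<le> (\<integral>x. \<bar>f x * \<phi> x\<bar> \<partial>lborel)" by (rule integral_abs_bound)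
  also have "\<dots> \<le> (\<integral>x. K * schwartz_bound \<phi> * inverse (1 + x\<^sup>2) \<partial>lborel)"
    by (intro integral_mono integrable_abs 1 int le)
  finally show "\<bar>\<integral>x. f x * \<phi> x \<partial>lborel\<bar> \<le> K * (\<integral>x. inverse (1 + x\<^sup>2) \<partial>lborel) * schwartz_bound \<phi>"
    by (simp add: mult_ac)
qed

lemma tempered_linear_growth:
  assumes f: "f \<in> borel_measurable borel" "\<And>x. \<bar>f x\<bar> \<le> K * (1 + \<bar>x\<bar>)"
  shows "tempered_distribution (distr_of_fun f)"
proof -
  have "K \<ge> 0" using f(2)[of 0] by simp
  let ?C = "K * (\<integral>x. inverse (1 + x\<^sup>2) \<partial>lborel)"
  have "\<bar>distr_of_fun f \<phi>\<bar> \<le> ?C * (\<Sum>k\<le>3. \<Sum>n\<le>3. schwartz_seminorm k n \<phi>)" if \<phi>: "\<phi> \<in> schwartz" for \<phi>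
  proof -
    have "\<bar>distr_of_fun f \<phi>\<bar> \<le> ?C * schwartz_bound \<phi>"
      unfolding distr_of_fun_def by (rule linear_growth_times_schwartz[OF f \<phi>])
    also have "\<dots> \<le> ?C * (\<Sum>k\<le>3. \<Sum>n\<le>3. schwartz_seminorm k n \<phi>)"
      unfolding schwartz_bound_def
    proof (intro mult_left_mono sum_mono mult_nonneg_nonneg \<open>K \<ge> 0\<close> integral_nonneg)
      fix k :: nat
      have "schwartz_seminorm k n \<phi> \<ge> 0" for n
        using schwartz_le_seminorm[OF \<phi>, of 0 k n] by linarith
      then show "schwartz_seminorm k 0 \<phi> \<le> (\<Sum>n\<le>3. schwartz_seminorm k n \<phi>)"
        by (intro member_le_sum) auto
    qed auto
    finally show ?thesis .
  qed
  moreover have "distr_of_fun f (\<lambda>x. a * \<phi> x + b * \<psi> x) = a * distr_of_fun f \<phi> + b * distr_of_fun f \<psi>"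
    if "\<phi> \<in> schwartz" "\<psi> \<in> schwartz" for \<phi> \<psi> a b
    using linear_growth_times_schwartz(1)[OF f that(1)] linear_growth_times_schwartz(1)[OF f that(2)]
    by (simp add: distr_of_fun_def distrib_left mult.left_commute)
  ultimately show ?thesis unfolding tempered_distribution_def by blast
qed

lemma inverse_1_plus_square_tendsto_0: "((\<lambda>x::real. C * inverse (1 + x\<^sup>2)) \<longlongrightarrow> 0) at_infinity"
proof -
  have "filterlim (\<lambda>x::real. 1 + (norm x)\<^sup>2) at_top at_infinity"
    by (intro filterlim_tendsto_add_at_top[OF tendsto_const] filterlim_pow_at_top filterlim_norm_at_top) auto
  then show ?thesis
    by (intro tendsto_mult_right_zero tendsto_inverse_0_at_top) simp
qed

lemma abs_affine_le: "\<bar>a + b * x\<bar> \<le> (\<bar>a\<bar> + \<bar>b\<bar>) * (1 + \<bar>x :: real\<bar>)"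
proof -
  have "\<bar>a + b * x\<bar> \<le> \<bar>a\<bar> + \<bar>b\<bar> * \<bar>x\<bar>" using abs_triangle_ineq[of a "b * x"] by (simp add: abs_mult)
  also have "\<dots> \<le> (\<bar>a\<bar> + \<bar>b\<bar>) * (1 + \<bar>x\<bar>)" by (simp add: algebra_simps)
  finally show ?thesis .
qed

lemma schwartz_tendsto_0:
  assumes "\<phi> \<in> schwartz" "F \<le> at_infinity"
  shows "((\<lambda>x. (a + b * x) * \<phi> x) \<longlongrightarrow> 0) F"
proof (rule tendsto_mono[OF assms(2)], rule Lim_null_comparison)
  show "((\<lambda>x::real. ((\<bar>a\<bar> + \<bar>b\<bar>) * schwartz_bound \<phi>) * inverse (1 + x\<^sup>2)) \<longlongrightarrow> 0) at_infinity"
    by (rule inverse_1_plus_square_tendsto_0)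
  have "\<bar>(a + b * x) * \<phi> x\<bar> \<le> (\<bar>a\<bar> + \<bar>b\<bar>) * schwartz_bound \<phi> * inverse (1 + x\<^sup>2)" for x
  proof -
    have "\<bar>a + b * x\<bar> * \<bar>\<phi> x\<bar> \<le> (\<bar>a\<bar> + \<bar>b\<bar>) * (1 + \<bar>x\<bar>) * \<bar>\<phi> x\<bar>"
      by (intro mult_right_mono abs_affine_le) auto
    also have "\<dots> \<le> (\<bar>a\<bar> + \<bar>b\<bar>) * (schwartz_bound \<phi> * inverse (1 + x\<^sup>2))"
      unfolding mult.assoc by (intro mult_left_mono abs_schwartz_le assms(1)) auto
    finally show ?thesis by (simp add: abs_mult)
  qed
  then show "\<forall>\<^sub>F x in at_infinity. norm ((a + b * x) * \<phi> x) \<le> ((\<bar>a\<bar> + \<bar>b\<bar>) * schwartz_bound \<phi>) * inverse (1 + x\<^sup>2)"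
    by (intro always_eventually) simp
qed

text \<open>
  Integrating by parts twice: the boundary terms form an explicit antiderivative, so that the integrals below follow
  from the fundamental theorem of calculus.
\<close>
lemma affine_deriv2_antiderivative:
  assumes "\<phi> \<in> schwartz"
  shows "((\<lambda>x. (a + b * x) * deriv \<phi> x - b * \<phi> x) has_real_derivative (a + b * x) * deriv (deriv \<phi>) x) (at x)"
  using schwartz_has_derivative[OF assms] schwartz_has_derivative[OF schwartz_deriv[OF assms]]
  by (auto intro!: derivative_eq_intros)

lemma affine_deriv2_antiderivative_tendsto_0:
  assumes "\<phi> \<in> schwartz" "F \<le> at_infinity"
  shows "((\<lambda>x. (a + b * x) * deriv \<phi> x - b * \<phi> x) \<longlongrightarrow> 0) F"
  using tendsto_diff[OF schwartz_tendsto_0[OF schwartz_deriv[OF assms(1)] assms(2), of a b]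
      schwartz_tendsto_0[OF assms, of b 0]] by simp

lemma integral_affine_deriv2:
  assumes \<phi>: "\<phi> \<in> schwartz"
  shows "(\<integral>x. (a + b * x) * deriv (deriv \<phi>) x \<partial>lborel) = 0"
proof -
  note \<phi>'' = schwartz_deriv[OF schwartz_deriv[OF \<phi>]]
  have "(LBINT x=-\<infinity>..\<infinity>. (a + b * x) * deriv (deriv \<phi>) x) = 0 - 0"
  proof (rule interval_integral_FTC_integrable)
    show "((\<lambda>x. (a + b * x) * deriv \<phi> x - b * \<phi> x) has_vector_derivative (a + b * x) * deriv (deriv \<phi>) x) (at x)" for x
      using affine_deriv2_antiderivative[OF \<phi>] by (simp add: has_real_derivative_iff_has_vector_derivative)
    show "isCont (\<lambda>x. (a + b * x) * deriv (deriv \<phi>) x) x" for x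
      using schwartz_continuous_on[OF \<phi>'', of UNIV] by (auto simp: continuous_on_eq_continuous_at intro!: continuous_intros)
    show "set_integrable lborel (einterval (-\<infinity>) \<infinity>) (\<lambda>x. (a + b * x) * deriv (deriv \<phi>) x)"
      using linear_growth_times_schwartz(1)[OF _ abs_affine_le \<phi>'', of a b] by (simp add: set_integrable_def)
    show "(((\<lambda>x. (a + b * x) * deriv \<phi> x - b * \<phi> x) \<circ> real_of_ereal) \<longlongrightarrow> 0) (at_right (-\<infinity>))"
      unfolding ereal_tendsto_simps using affine_deriv2_antiderivative_tendsto_0[OF \<phi> at_bot_le_at_infinity] .
    show "(((\<lambda>x. (a + b * x) * deriv \<phi> x - b * \<phi> x) \<circ> real_of_ereal) \<longlongrightarrow> 0) (at_left \<infinity>)"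
      unfolding ereal_tendsto_simps using affine_deriv2_antiderivative_tendsto_0[OF \<phi> at_top_le_at_infinity] .
  qed simp
  then show ?thesis by (simp add: interval_lebesgue_integral_def set_lebesgue_integral_def)
qed

text \<open>
  The second distributional derivative of a ramp is the point mass at its knot.
\<close>
lemma integral_ramp_deriv2:
  assumes \<phi>: "\<phi> \<in> schwartz"
  shows "(\<integral>x. max 0 (x - s) * deriv (deriv \<phi>) x \<partial>lborel) = \<phi> s"
proof -
  note \<phi>'' = schwartz_deriv[OF schwartz_deriv[OF \<phi>]]
  have "(LBINT x=ereal s..\<infinity>. (- s + 1 * x) * deriv (deriv \<phi>) x) = 0 - (- \<phi> s)"
  proof (rule interval_integral_FTC_integrable)
    show "((\<lambda>x. (- s + 1 * x) * deriv \<phi> x - 1 * \<phi> x) has_vector_derivative (- s + 1 * x) * deriv (deriv \<phi>) x) (at x)" for x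
      using affine_deriv2_antiderivative[OF \<phi>, of "- s" 1 x] by (simp only: has_real_derivative_iff_has_vector_derivative)
    show "isCont (\<lambda>x. (- s + 1 * x) * deriv (deriv \<phi>) x) x" for x
      using schwartz_continuous_on[OF \<phi>'', of UNIV] by (auto simp: continuous_on_eq_continuous_at intro!: continuous_intros)
    show "set_integrable lborel (einterval (ereal s) \<infinity>) (\<lambda>x. (- s + 1 * x) * deriv (deriv \<phi>) x)"
      unfolding set_integrable_def
      using linear_growth_times_schwartz(1)[OF _ abs_affine_le \<phi>'', of "- s" 1]
      by (intro integrable_mult_indicator) (auto simp: einterval_def)
    have "isCont (\<lambda>x. (- s + 1 * x) * deriv \<phi> x - 1 * \<phi> x) s"
      using affine_deriv2_antiderivative[OF \<phi>] by (rule DERIV_isCont)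
    then have "((\<lambda>x. (- s + 1 * x) * deriv \<phi> x - 1 * \<phi> x) \<longlongrightarrow> - \<phi> s) (at s)"
      by (simp add: isCont_def)
    then show "(((\<lambda>x. (- s + 1 * x) * deriv \<phi> x - 1 * \<phi> x) \<circ> real_of_ereal) \<longlongrightarrow> - \<phi> s) (at_right (ereal s))"
      unfolding ereal_tendsto_simps by (rule filterlim_at_split[THEN iffD1, THEN conjunct2])
    show "(((\<lambda>x. (- s + 1 * x) * deriv \<phi> x - 1 * \<phi> x) \<circ> real_of_ereal) \<longlongrightarrow> 0) (at_left \<infinity>)"
      unfolding ereal_tendsto_simps using affine_deriv2_antiderivative_tendsto_0[OF \<phi> at_top_le_at_infinity] .
  qed simp
  moreover have eq: "max 0 (x - s) * deriv (deriv \<phi>) x = indicator {s<..} x * ((- s + 1 * x) * deriv (deriv \<phi>) x)" for x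
    by (auto simp: indicator_def max_def)
  have "(\<integral>x. max 0 (x - s) * deriv (deriv \<phi>) x \<partial>lborel) =
      (LBINT x=ereal s..\<infinity>. (- s + 1 * x) * deriv (deriv \<phi>) x)"
    unfolding eq by (simp add: interval_lebesgue_integral_def set_lebesgue_integral_def)
  ultimately show ?thesis by simp
qed

lemma linear_spline_in_BV2:
  fixes a b :: real and c k :: "'i \<Rightarrow> real"
  assumes I: "finite I" "inj_on k I"
  defines "f \<equiv> \<lambda>t. a + b * t + (\<Sum>i\<in>I. c i * max 0 (t - k i))"
  shows "f \<in> BV2" and "is_distr_measure (distr_D2 (distr_of_fun f)) (atomic_measure I c k)"
proof -
  have cont: "continuous_on UNIV f"
    unfolding f_def by (intro continuous_intros)
  then have f: "f \<in> borel_measurable borel" by (rule borel_measurable_continuous_onI)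
  have ramp: "\<bar>max 0 (t - s)\<bar> \<le> (1 + \<bar>s\<bar>) * (1 + \<bar>t\<bar>)" for s t :: real
  proof -
    have "\<bar>max 0 (t - s)\<bar> \<le> \<bar>t - s\<bar>" by (simp add: max_def)
    also have "\<dots> \<le> (1 + \<bar>s\<bar>) * (1 + \<bar>t\<bar>)"
      using abs_affine_le[of "- s" 1 t] by (simp add: add.commute)
    finally show ?thesis .
  qed
  \<comment> \<open>constant of linear growth, which makes the spline a tempered distribution\<close>
  define K where "K = \<bar>a\<bar> + \<bar>b\<bar> + (\<Sum>i\<in>I. \<bar>c i\<bar> * (1 + \<bar>k i\<bar>))"
  have growth: "\<bar>f t\<bar> \<le> K * (1 + \<bar>t\<bar>)" for t
  proof -
    have "\<bar>\<Sum>i\<in>I. c i * max 0 (t - k i)\<bar> \<le> (\<Sum>i\<in>I. \<bar>c i * max 0 (t - k i)\<bar>)" by (rule sum_abs)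
    also have "\<dots> \<le> (\<Sum>i\<in>I. \<bar>c i\<bar> * ((1 + \<bar>k i\<bar>) * (1 + \<bar>t\<bar>)))"
      unfolding abs_mult by (intro sum_mono mult_left_mono ramp) auto
    finally have "\<bar>f t\<bar> \<le> (\<bar>a\<bar> + \<bar>b\<bar>) * (1 + \<bar>t\<bar>) + (\<Sum>i\<in>I. \<bar>c i\<bar> * ((1 + \<bar>k i\<bar>) * (1 + \<bar>t\<bar>)))"
      using abs_affine_le[of a b t] unfolding f_def by linarith
    then show ?thesis by (simp add: K_def distrib_right sum_distrib_right mult.assoc)
  qed
  show D2: "is_distr_measure (distr_D2 (distr_of_fun f)) (atomic_measure I c k)"
    unfolding is_distr_measure_def
  proof (intro conjI ballI signed_measure_atomic_measure)
    fix \<phi> assume \<phi>: "\<phi> \<in> schwartz"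
    note \<phi>'' = schwartz_deriv[OF schwartz_deriv[OF \<phi>]]
    have "has_bochner_integral lborel (\<lambda>x. (a + b * x) * deriv (deriv \<phi>) x) 0"
      using integral_affine_deriv2[OF \<phi>, of a b] linear_growth_times_schwartz(1)[OF _ abs_affine_le \<phi>'', of a b]
      by (simp add: has_bochner_integral_iff)
    moreover have "has_bochner_integral lborel (\<lambda>x. max 0 (x - s) * deriv (deriv \<phi>) x) (\<phi> s)" for s
      using integral_ramp_deriv2[OF \<phi>, of s] linear_growth_times_schwartz(1)[OF _ ramp \<phi>'', of s]
      by (simp add: has_bochner_integral_iff)
    ultimately have "has_bochner_integral lborel (\<lambda>x. (a + b * x) * deriv (deriv \<phi>) x
        + (\<Sum>i\<in>I. c i * (max 0 (x - k i) * deriv (deriv \<phi>) x))) (0 + (\<Sum>i\<in>I. c i * \<phi> (k i)))"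
      by (intro has_bochner_integral_add has_bochner_integral_sum has_bochner_integral_mult_right)
    then have "has_bochner_integral lborel (\<lambda>x. f x * deriv (deriv \<phi>) x) (\<Sum>i\<in>I. c i * \<phi> (k i))"
      by (simp add: f_def distrib_right sum_distrib_right mult.assoc)
    then show "distr_D2 (distr_of_fun f) \<phi> = signed_integral (atomic_measure I c k) \<phi>"
      using signed_integral_atomic_measure[OF I schwartz_borel_measurable[OF \<phi>], of c]
      by (simp add: distr_D2_def distr_of_fun_def has_bochner_integral_integral_eq)
  qed
  show "f \<in> BV2"
    unfolding BV2_def BV2_distr_def
    using cont D2 tempered_linear_growth[OF f growth] linear_growth_times_schwartz(1)[OF f growth] by blast
qed

section \<open>The canonical interpolant is a solution\<close>

lemma cano_coeff_eq_kink: "i \<in> {2..M - 1} \<Longrightarrow> cano_coeff M x y i = kink x y i"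
  by (auto simp: cano_coeff_def kink_def slope_def)

lemma kink_cong:
  assumes "\<And>j. j \<in> {1..M} \<Longrightarrow> x j = x' j" "\<And>j. j \<in> {1..M} \<Longrightarrow> v j = v' j" "i \<in> {2..M - 1}"
  shows "kink x v i = kink x' v' i"
proof -
  have "{i - 1, i, Suc i} \<subseteq> {1..M}" "Suc (i - 1) = i" using assms(3) by auto
  then show ?thesis using assms(1,2) by (simp add: kink_def slope_def)
qed

lemma node_less:
  fixes x :: "nat \<Rightarrow> real"
  assumes "strict_mono_on {1..M} x" "1 \<le> i" "i < j" "j \<le> M"
  shows "x i < x j"
  by (rule strict_mono_onD[OF assms(1)]) (use assms in auto)

lemma node_le:
  fixes x :: "nat \<Rightarrow> real"
  assumes "strict_mono_on {1..M} x" "1 \<le> i" "i \<le> j" "j \<le> M"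
  shows "x i \<le> x j"
  using node_less[OF assms(1,2) _ assms(4)] assms(3) by (cases "i = j") auto

lemma slope_times_step:
  assumes "strict_mono_on {1..M} x" "1 \<le> J" "J < M"
  shows "y J + slope x y J * (x (Suc J) - x J) = y (Suc J)"
  using node_less[OF assms(1,2), of "Suc J"] assms(3) by (simp add: slope_def)

text \<open>
  On the piece that starts at node \<open>J\<close> exactly the ramps of the nodes \<open>2, \<dots>, J\<close> are active, and their kinks add up to
  \<open>s\<^sub>J - s\<^sub>1\<close>.  The first and last piece extend to infinity, which the disjunctions in the
  assumptions express.
\<close>
lemma f_cano_on_piece:
  assumes x: "strict_mono_on {1..M} x" and J: "1 \<le> J" "J < M"
    and left: "J = 1 \<or> x J \<le> t" and right: "J = M - 1 \<or> t \<le> x (Suc J)"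
  shows "f_cano M x y t = y J + slope x y J * (t - x J)"
proof -
  have partial: "slope x y 1 * t + (y 1 - slope x y 1 * x 1) + (\<Sum>m = 2..J. kink x y m * (t - x m)) =
      y J + slope x y J * (t - x J)"
    using J
  proof (induction J rule: dec_induct)
    case base
    show ?case by (simp add: algebra_simps)
  next
    case (step J)
    have "{2..Suc J} = insert (Suc J) {2..J}" using step by auto
    then have "slope x y 1 * t + (y 1 - slope x y 1 * x 1) + (\<Sum>m = 2..Suc J. kink x y m * (t - x m)) =
        y J + slope x y J * (t - x J) + kink x y (Suc J) * (t - x (Suc J))"
      using step by simp
    also have "\<dots> = y J + slope x y J * (x (Suc J) - x J) + slope x y (Suc J) * (t - x (Suc J))"
      by (simp add: kink_def algebra_simps)
    finally show ?case using slope_times_step[OF x, of J] step by simp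
  qed
  have "(\<Sum>m = 2..M - 1. cano_coeff M x y m * max 0 (t - x m)) =
      (\<Sum>m = 2..M - 1. kink x y m * max 0 (t - x m))"
    by (intro sum.cong) (auto simp: cano_coeff_eq_kink)
  also have "\<dots> = (\<Sum>m = 2..J. kink x y m * (t - x m))"
  proof (rule sum.mono_neutral_cong_right)
    show "\<forall>m\<in>{2..M - 1} - {2..J}. kink x y m * max 0 (t - x m) = 0"
    proof
      fix m assume m: "m \<in> {2..M - 1} - {2..J}"
      then have "x (Suc J) \<le> x m" using J by (intro node_le[OF x]) auto
      then show "kink x y m * max 0 (t - x m) = 0" using right m J by auto
    qed
    show "kink x y m * max 0 (t - x m) = kink x y m * (t - x m)" if m: "m \<in> {2..J}" for m
    proof -
      have "x m \<le> x J" using m J by (intro node_le[OF x]) auto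
      then show ?thesis using left m by auto
    qed
  qed (use J in auto)
  finally show ?thesis
    unfolding f_cano_def using partial J by (simp add: cano_coeff_def slope_def numeral_2_eq_2)
qed

lemma f_cano_interpolates:
  assumes x: "strict_mono_on {1..M} x" and "2 \<le> M" "j \<in> {1..M}"
  shows "f_cano M x y (x j) = y j"
proof (cases "j = M")
  case True
  define J where "J = M - 1"
  have J: "1 \<le> J" "J < M" "M = Suc J" using assms by (auto simp: J_def)
  then show ?thesis
    using f_cano_on_piece[OF x J(1,2), of "x M" y] slope_times_step[OF x J(1,2), of y]
      node_le[OF x J(1), of M] True by simp
next
  case False
  then show ?thesis
    using f_cano_on_piece[OF x, of j "x j" y] node_le[OF x, of j "Suc j"] assms by simp
qed

lemma f_cano_BV2:
  assumes x: "strict_mono_on {1..M} x"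
  shows "f_cano M x y \<in> BV2"
    and "tv_norm (D2_measure (f_cano M x y)) = (\<Sum>i = 2..M - 1. \<bar>kink x y i\<bar>)"
proof -
  have inj: "inj_on x {2..M - 1}"
    using strict_mono_on_imp_inj_on[OF x] by (rule inj_on_subset) auto
  have eq: "f_cano M x y = (\<lambda>t. cano_coeff M x y M + cano_coeff M x y 1 * t +
      (\<Sum>m = 2..M - 1. cano_coeff M x y m * max 0 (t - x m)))"
    by (simp add: f_cano_def fun_eq_iff)
  note spline = linear_spline_in_BV2[OF finite_atLeastAtMost inj, of "cano_coeff M x y M" "cano_coeff M x y 1" "cano_coeff M x y", folded eq]
  show "f_cano M x y \<in> BV2" by (rule spline(1))
  have "D2_measure (f_cano M x y) = atomic_measure {2..M - 1} (cano_coeff M x y) x"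
    by (rule D2_measure_eqI[OF spline(2)])
  then show "tv_norm (D2_measure (f_cano M x y)) = (\<Sum>i = 2..M - 1. \<bar>kink x y i\<bar>)"
    using cano_coeff_eq_kink[of _ M x y]
    by (simp only: tv_norm_atomic_measure[OF finite_atLeastAtMost inj] cong: sum.cong)
qed

lemma f_cano_feasible:
  assumes "strict_mono_on {1..M} x" "2 \<le> M"
  shows "f_cano M x y \<in> gBPC_feasible M x y"
  using assms by (simp add: gBPC_feasible_def f_cano_BV2 f_cano_interpolates)

text \<open>
  The canonical interpolant shows that the lower bound is the minimum.
\<close>
lemma gBPC_solutions_iff:
  assumes x: "strict_mono_on {1..M} x" and "2 \<le> M"
  shows "f \<in> gBPC_solutions M x y \<longleftrightarrow>
    f \<in> gBPC_feasible M x y \<and> tv_norm (D2_measure f) \<le> (\<Sum>i = 2..M - 1. \<bar>kink x y i\<bar>)"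
proof -
  have "(\<Sum>i = 2..M - 1. \<bar>kink x y i\<bar>) \<le> tv_norm (D2_measure g)" if g: "g \<in> gBPC_feasible M x y" for g
  proof -
    have "(\<Sum>i = 2..M - 1. \<bar>kink x y i\<bar>) = (\<Sum>i = 2..M - 1. \<bar>kink x (\<lambda>j. g (x j)) i\<bar>)"
      using g kink_cong[of M x x y "\<lambda>j. g (x j)"] by (intro sum.cong) (auto simp: gBPC_feasible_def)
    then show ?thesis using sum_kinks_le_tv_norm[OF _ assms] g by (simp add: gBPC_feasible_def)
  qed
  then show ?thesis
    using f_cano_feasible[OF assms, of y] f_cano_BV2(2)[OF x, of y]
    unfolding gBPC_solutions_def by (auto intro: order_trans)
qed

section \<open>Inserting an additional data point\<close>

text \<open>
  The new entry gets index \<open>k\<close> and the entries from \<open>k\<close> on move up by one.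
\<close>
definition insert_at :: "nat \<Rightarrow> 'a \<Rightarrow> (nat \<Rightarrow> 'a) \<Rightarrow> nat \<Rightarrow> 'a" where
  "insert_at k t x i = (if i < k then x i else if i = k then t else x (i - 1))"

lemma insert_at_simps [simp]:
  "i < k \<Longrightarrow> insert_at k t x i = x i"
  "insert_at k t x k = t"
  "k \<le> i \<Longrightarrow> insert_at k t x (Suc i) = x i"
  by (auto simp: insert_at_def)

lemma strict_mono_on_insert_at:
  assumes x: "strict_mono_on {1..M} x" and k: "k \<in> {1..M + 1}"
    and left: "k = 1 \<or> x (k - 1) < t" and right: "k = M + 1 \<or> t < (x k :: real)"
  shows "strict_mono_on {1..M + 1} (insert_at k t x)"
proof (rule strict_mono_onI)
  fix r s assume rs: "r \<in> {1..M + 1}" "s \<in> {1..M + 1}" "r < s"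
  consider "s < k" | "s = k" | "r = k" | "r < k" "k < s" | "k < r" using rs(3) by linarith
  then show "insert_at k t x r < insert_at k t x s"
  proof cases
    case 1
    then show ?thesis using rs k by (simp add: node_less[OF x])
  next
    case 2
    then have "x r \<le> x (k - 1)" using rs k by (intro node_le[OF x]) auto
    then show ?thesis using 2 rs left by auto
  next
    case 3
    then have "x k \<le> x (s - 1)" using rs k by (intro node_le[OF x]) auto
    then show ?thesis using 3 rs right by (auto simp: insert_at_def)
  next
    case 4
    then have "x r < x (s - 1)" using rs k by (intro node_less[OF x]) auto
    then show ?thesis using 4 by (simp add: insert_at_def)
  next
    case 5
    then have "x (r - 1) < x (s - 1)" using rs k by (intro node_less[OF x]) auto
    then show ?thesis using 5 rs(3) by (simp add: insert_at_def)
  qed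
qed

lemma slope_insert_at:
  "Suc i < k \<Longrightarrow> slope (insert_at k t x) (insert_at k v y) i = slope x y i"
  "k \<ge> 1 \<Longrightarrow> slope (insert_at k t x) (insert_at k v y) (k - 1) = (v - y (k - 1)) / (t - x (k - 1))"
  "slope (insert_at k t x) (insert_at k v y) k = (y k - v) / (x k - t)"
  "k \<le> i \<Longrightarrow> slope (insert_at k t x) (insert_at k v y) (Suc i) = slope x y i"
  by (simp_all add: slope_def)

lemma kink_insert_at:
  "Suc i < k \<Longrightarrow> kink (insert_at k t x) (insert_at k v y) i = kink x y i"
  "k < i \<Longrightarrow> kink (insert_at k t x) (insert_at k v y) (Suc i) = kink x y i"
  using slope_insert_at(4)[of k "i - 1"] slope_insert_at(4)[of k i] slope_insert_at(1)[of i k] slope_insert_at(1)[of "i - 1" k]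
  by (auto simp: kink_def)

text \<open>
  Only the kinks at the new node and at its two neighbours are affected.  The intersections with
  \<open>{2..M}\<close> and \<open>{2..M - 1}\<close> cover the insertions near and beyond the ends of the data, where some of these
  kinks do not exist.
\<close>
lemma sum_kinks_insert_at:
  fixes x y :: "nat \<Rightarrow> real" and t v :: real
  assumes k: "k \<in> {1..M + 1}" and "2 \<le> M"
  defines "K \<equiv> \<lambda>i. \<bar>kink x y i\<bar>" and "K' \<equiv> \<lambda>i. \<bar>kink (insert_at k t x) (insert_at k v y) i\<bar>"
  shows "sum K' {2..M} - sum K {2..M - 1} = sum K' ({k - 1..k + 1} \<inter> {2..M}) - sum K ({k - 1..k} \<inter> {2..M - 1})"
proof -
  have "sum K' {2..M} = sum K' ({2..<k - 1} \<union> ({k - 1..k + 1} \<inter> {2..M}) \<union> {k + 2..M})"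
    using k by (intro arg_cong2[where f = sum]) auto
  also have "\<dots> = sum K' {2..<k - 1} + sum K' ({k - 1..k + 1} \<inter> {2..M}) + sum K' {k + 2..M}"
    by (subst sum.union_disjoint; (subst sum.union_disjoint)?) auto
  also have "sum K' {2..<k - 1} = sum K {2..<k - 1}"
    unfolding K_def K'_def by (intro sum.cong) (auto simp: kink_insert_at(1))
  also have "sum K' {k + 2..M} = sum K' {Suc (k + 1)..Suc (M - 1)}"
    using \<open>2 \<le> M\<close> by simp
  also have "\<dots> = sum K {k + 1..M - 1}"
    unfolding sum.shift_bounds_cl_Suc_ivl K_def K'_def by (intro sum.cong) (auto simp: kink_insert_at(2))
  finally have 1: "sum K' {2..M} = sum K {2..<k - 1} + sum K' ({k - 1..k + 1} \<inter> {2..M}) + sum K {k + 1..M - 1}" .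
  have "sum K {2..M - 1} = sum K ({2..<k - 1} \<union> ({k - 1..k} \<inter> {2..M - 1}) \<union> {k + 1..M - 1})"
    using k by (intro arg_cong2[where f = sum]) auto
  also have "\<dots> = sum K {2..<k - 1} + sum K ({k - 1..k} \<inter> {2..M - 1}) + sum K {k + 1..M - 1}"
    by (subst sum.union_disjoint; (subst sum.union_disjoint)?) auto
  finally show ?thesis using 1 by simp
qed

text \<open>
  Interpolating the refined data means interpolating the old data and passing through \<open>(t, v)\<close>.  So
  a solution through \<open>(t, v)\<close> obeys the lower bound of the refined data, and the canonical interpolant of the
  refined data witnesses the converse.
\<close>
lemma ex_solution_through_iff:
  assumes x: "strict_mono_on {1..M} x" and "2 \<le> M" and k: "k \<in> {1..M + 1}"
    and left: "k = 1 \<or> x (k - 1) < t" and right: "k = M + 1 \<or> t < x k"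
  shows "(\<exists>f\<in>gBPC_solutions M x y. f t = v) \<longleftrightarrow>
    (\<Sum>i\<in>{k - 1..k + 1} \<inter> {2..M}. \<bar>kink (insert_at k t x) (insert_at k v y) i\<bar>) \<le>
    (\<Sum>i\<in>{k - 1..k} \<inter> {2..M - 1}. \<bar>kink x y i\<bar>)"
    (is "_ \<longleftrightarrow> ?mid' \<le> ?mid")
proof -
  let ?x = "insert_at k t x" and ?y = "insert_at k v y"
  have x': "strict_mono_on {1..M + 1} ?x" by (rule strict_mono_on_insert_at[OF x k left right])
  have "?mid' \<le> ?mid \<longleftrightarrow> (\<Sum>i = 2..M + 1 - 1. \<bar>kink ?x ?y i\<bar>) \<le> (\<Sum>i = 2..M - 1. \<bar>kink x y i\<bar>)"
    using sum_kinks_insert_at[OF k \<open>2 \<le> M\<close>, of t x v y]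
    unfolding add_diff_cancel_right' by linarith
  moreover have feasible_iff: "f \<in> gBPC_feasible (M + 1) ?x ?y \<longleftrightarrow> f \<in> gBPC_feasible M x y \<and> f t = v" for f
  proof -
    have "(\<forall>m\<in>{1..M + 1}. f (?x m) = ?y m) \<longleftrightarrow> (\<forall>m\<in>{1..M}. f (x m) = y m) \<and> f t = v" (is "?L \<longleftrightarrow> ?R")
    proof
      assume L: ?L
      have "f (x m) = y m" if "m \<in> {1..M}" for m
        using bspec[OF L, of m] bspec[OF L, of "Suc m"] that by (cases "m < k") auto
      then show ?R using bspec[OF L k] by simp
    next
      assume R: ?R
      have "f (?x m) = ?y m" if m: "m \<in> {1..M + 1}" for m
      proof -
        consider "m < k" | "m = k" | "m > k" by linarith
        then show ?thesis
        proof cases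
          case 1
          then have "m \<in> {1..M}" using m k by auto
          then show ?thesis using R 1 by simp
        next
          case 3
          then have "m - 1 \<in> {1..M}" using m k by auto
          then show ?thesis using R 3 by (simp add: insert_at_def)
        qed (use R in simp)
      qed
      then show ?L by blast
    qed
    then show ?thesis by (auto simp: gBPC_feasible_def)
  qed
  moreover have "(\<exists>f\<in>gBPC_solutions M x y. f t = v) \<longleftrightarrow>
      (\<Sum>i = 2..M + 1 - 1. \<bar>kink ?x ?y i\<bar>) \<le> (\<Sum>i = 2..M - 1. \<bar>kink x y i\<bar>)"
  proof
    assume "\<exists>f\<in>gBPC_solutions M x y. f t = v"
    then obtain f where f: "f \<in> gBPC_solutions M x y" "f t = v" by blast
    then have feas: "f \<in> gBPC_feasible (M + 1) ?x ?y" and "tv_norm (D2_measure f) \<le> (\<Sum>i = 2..M - 1. \<bar>kink x y i\<bar>)"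
      unfolding feasible_iff by (simp_all add: gBPC_solutions_iff[OF x \<open>2 \<le> M\<close>])
    moreover have "(\<Sum>i = 2..M + 1 - 1. \<bar>kink ?x ?y i\<bar>) = (\<Sum>i = 2..M + 1 - 1. \<bar>kink ?x (\<lambda>j. f (?x j)) i\<bar>)"
      using feas kink_cong[of "M + 1" ?x ?x ?y "\<lambda>j. f (?x j)"]
      by (intro sum.cong) (auto simp: gBPC_feasible_def)
    ultimately show "(\<Sum>i = 2..M + 1 - 1. \<bar>kink ?x ?y i\<bar>) \<le> (\<Sum>i = 2..M - 1. \<bar>kink x y i\<bar>)"
      using sum_kinks_le_tv_norm[OF _ x', of f] \<open>2 \<le> M\<close> by (simp add: gBPC_feasible_def)
  next
    assume le: "(\<Sum>i = 2..M + 1 - 1. \<bar>kink ?x ?y i\<bar>) \<le> (\<Sum>i = 2..M - 1. \<bar>kink x y i\<bar>)"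
    have "f_cano (M + 1) ?x ?y \<in> gBPC_feasible (M + 1) ?x ?y"
      using \<open>2 \<le> M\<close> by (intro f_cano_feasible[OF x']) simp
    then have "f_cano (M + 1) ?x ?y \<in> gBPC_solutions M x y" "f_cano (M + 1) ?x ?y t = v"
      unfolding feasible_iff using le f_cano_BV2(2)[OF x', of ?y]
      by (simp_all add: gBPC_solutions_iff[OF x \<open>2 \<le> M\<close>])
    then show "\<exists>f\<in>gBPC_solutions M x y. f t = v" by blast
  qed
  ultimately show ?thesis by simp
qed

text \<open>
  Depth \<open>w\<close> below the chord lowers the slope left of \<open>t\<close> by \<open>w / u\<close> and raises the slope right of \<open>t\<close> by
  \<open>w / r\<close>.
\<close>
lemma kinks_insert_between:
  fixes x y :: "nat \<Rightarrow> real" and t v :: real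
  assumes x: "strict_mono_on {1..M} x" and m: "1 \<le> m" "m < M" and t: "x m < t" "t < x (Suc m)"
  defines "u \<equiv> t - x m" and "r \<equiv> x (Suc m) - t" and "w \<equiv> y m + slope x y m * (t - x m) - v"
  defines "K \<equiv> kink (insert_at (Suc m) t x) (insert_at (Suc m) v y)"
  shows "2 \<le> m \<Longrightarrow> K m = kink x y m - w / u"
    and "K (Suc m) = w / u + w / r"
    and "K (Suc (Suc m)) = kink x y (Suc m) - w / r"
proof -
  have pos: "u > 0" "r > 0" using t by (auto simp: u_def r_def)
  have "y (Suc m) - v = slope x y m * r + w"
    using slope_times_step[OF x m, of y] by (simp add: w_def r_def algebra_simps)
  then have q: "slope (insert_at (Suc m) t x) (insert_at (Suc m) v y) (Suc m) = slope x y m + w / r"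
    using pos slope_insert_at(3)[of "Suc m" t x v y] by (simp add: add_divide_distrib flip: r_def)
  have "v - y m = slope x y m * u - w" by (simp add: w_def u_def)
  then have p: "slope (insert_at (Suc m) t x) (insert_at (Suc m) v y) m = slope x y m - w / u"
    using pos slope_insert_at(2)[of "Suc m" t x v y] by (simp add: diff_divide_distrib flip: u_def)
  show "K m = kink x y m - w / u" if "2 \<le> m"
    using that slope_insert_at(1)[of "m - 1" "Suc m" t x v y] by (simp add: K_def kink_def p)
  show "K (Suc m) = w / u + w / r" by (simp add: K_def kink_def p q)
  show "K (Suc (Suc m)) = kink x y (Suc m) - w / r"
    using slope_insert_at(4)[of "Suc m" "Suc m" t x v y] by (simp add: K_def kink_def q)
qed

section \<open>When a refinement does not increase the total kink\<close>

text \<open>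
  Equality case of \<open>\<bar>a\<bar> \<le> \<bar>a - P\<bar> + \<bar>P\<bar>\<close> and \<open>\<bar>b\<bar> \<le> \<bar>b - Q\<bar> + \<bar>Q\<bar>\<close> for \<open>P = w / u\<close> and \<open>Q = w / r\<close>, which have the same
  sign.  The right-hand side is written with \<open>w / a\<close> and \<open>w / b\<close> so that it covers both signs of the kinks.
\<close>
lemma mid_condition:
  fixes a b w u r :: real
  assumes "u > 0" "r > 0"
  shows "\<bar>a - w / u\<bar> + \<bar>w / u + w / r\<bar> + \<bar>b - w / r\<bar> \<le> \<bar>a\<bar> + \<bar>b\<bar> \<longleftrightarrow>
    w = 0 \<or> (a * b > 0 \<and> 0 \<le> w / a \<and> w / a \<le> u \<and> w / b \<le> r)"
proof -
  have pos: "\<bar>a - w / u\<bar> + \<bar>w / u + w / r\<bar> + \<bar>b - w / r\<bar> \<le> \<bar>a\<bar> + \<bar>b\<bar> \<longleftrightarrow>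
      a * b > 0 \<and> 0 \<le> w / a \<and> w / a \<le> u \<and> w / b \<le> r" if "w > 0" for a b w
  proof -
    have wu: "w / u > 0" and wr: "w / r > 0" using that assms by auto
    have "\<bar>a - w / u\<bar> + \<bar>w / u + w / r\<bar> + \<bar>b - w / r\<bar> \<le> \<bar>a\<bar> + \<bar>b\<bar> \<longleftrightarrow> w / u \<le> a \<and> w / r \<le> b"
      using wu wr by linarith
    also have "\<dots> \<longleftrightarrow> a > 0 \<and> b > 0 \<and> w / a \<le> u \<and> w / b \<le> r"
    proof -
      have "w / s \<le> c \<longleftrightarrow> c > 0 \<and> w / c \<le> s" if s: "s > 0" "w / s > 0" for s c :: real
      proof (cases "c > 0")
        case True
        then show ?thesis using s(1) by (simp add: field_simps)
      qed (use s(2) in auto)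
      from this[OF assms(1) wu] this[OF assms(2) wr] show ?thesis by blast
    qed
    also have "\<dots> \<longleftrightarrow> a * b > 0 \<and> 0 \<le> w / a \<and> w / a \<le> u \<and> w / b \<le> r"
      using that by (auto simp: zero_less_mult_iff zero_le_divide_iff)
    finally show ?thesis .
  qed
  consider "w > 0" | "w = 0" | "- w > 0" by linarith
  then show ?thesis
  proof cases
    case 3
    have "\<bar>a - w / u\<bar> + \<bar>w / u + w / r\<bar> + \<bar>b - w / r\<bar> =
        \<bar>- a - - w / u\<bar> + \<bar>- w / u + - w / r\<bar> + \<bar>- b - - w / r\<bar>"
      by (simp add: abs_if)
    then show ?thesis using pos[OF 3, of "- a" "- b"] 3 by simp
  qed (use pos in auto)
qed

text \<open>
  The case of an outermost interval: without a second kink to trade with, the new kink cannot be compensated.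
\<close>
lemma end_condition:
  fixes b w u r :: real
  assumes "u > 0" "r > 0"
  shows "\<bar>w / u + w / r\<bar> + \<bar>b - w / r\<bar> \<le> \<bar>b\<bar> \<longleftrightarrow> w = 0"
proof
  assume le: "\<bar>w / u + w / r\<bar> + \<bar>b - w / r\<bar> \<le> \<bar>b\<bar>"
  have "\<bar>w / u + w / r\<bar> = \<bar>w / u\<bar> + \<bar>w / r\<bar>"
  proof (cases "w \<ge> 0")
    case False
    then have "w / u < 0" "w / r < 0" using assms by (auto intro: divide_neg_pos)
    then show ?thesis by linarith
  qed (use assms in simp)
  then have "\<bar>w / u\<bar> = 0" using le by linarith
  then show "w = 0" using assms by simp
qed simp

section \<open>The triangles in coordinates\<close>

lemma affine_hull_2_graph:
  fixes X1 :: real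
  assumes "X1 \<noteq> X2"
  shows "affine hull {(X1, Y1), (X2, Y2)} = {(t, v). v = Y1 + (Y2 - Y1) / (X2 - X1) * (t - X1)}"
proof (intro equalityI subsetI)
  fix p assume "p \<in> affine hull {(X1, Y1), (X2, Y2)}"
  then obtain a b where "a + b = 1" "p = a *\<^sub>R (X1, Y1) + b *\<^sub>R (X2, Y2)" by (auto simp: affine_hull_2)
  moreover have "a = 1 - b" using \<open>a + b = 1\<close> by simp
  ultimately show "p \<in> {(t, v). v = Y1 + (Y2 - Y1) / (X2 - X1) * (t - X1)}"
    using assms by (simp add: field_simps)
next
  fix p assume "p \<in> {(t, v). v = Y1 + (Y2 - Y1) / (X2 - X1) * (t - X1)}"
  then obtain t v where p: "p = (t, v)" "v = Y1 + (Y2 - Y1) / (X2 - X1) * (t - X1)" by auto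
  define b where "b = (t - X1) / (X2 - X1)"
  have "b * (X2 - X1) = t - X1" using assms by (simp add: b_def)
  then have "t = (1 - b) * X1 + b * X2" by (simp add: algebra_simps)
  moreover have "v = Y1 + (Y2 - Y1) * b" using p(2) by (simp add: b_def)
  then have "v = (1 - b) * Y1 + b * Y2" by (simp add: algebra_simps)
  ultimately show "p \<in> affine hull {(X1, Y1), (X2, Y2)}"
    unfolding affine_hull_2 p(1) by (intro CollectI exI[of _ "1 - b"] exI[of _ b]) simp
qed

text \<open>
  At distance \<open>s\<close> from node \<open>m\<close> the two extended segments meet if \<open>(a + b) * s = b * h\<close>, where \<open>a, b\<close> are the kinks and
  \<open>h\<close> is the length of the interval.
\<close>
lemma apex_eq:
  assumes x: "strict_mono_on {1..M} x" and m: "m \<in> {2..M - 2}"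
    and sum: "kink x y m + kink x y (Suc m) \<noteq> 0"
  defines "u \<equiv> kink x y (Suc m) / (kink x y m + kink x y (Suc m)) * (x (Suc m) - x m)"
  shows "apex x y m = (x m + u, y m + slope x y (m - 1) * u)"
proof -
  define n where "n = m - 1"
  have n: "m = Suc n" "1 \<le> n" "m < M" "Suc (Suc (Suc n)) \<le> M" using m by (auto simp: n_def)
  have less: "x n < x m" "x m < x (Suc m)" "x (Suc m) < x (Suc (Suc m))"
    using n m by (auto intro!: node_less[OF x])
  define h where "h = x (Suc m) - x m"
  have L: "affine hull {data_point x y (m - 1), data_point x y m} = {(t, v). v = y m + slope x y (m - 1) * (t - x m)}"
  proof -
    have "y n + slope x y n * (t - x n) = y m + slope x y n * (t - x m)" for t
      using slope_times_step[OF x n(2), of y] n by (simp add: algebra_simps)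
    then show ?thesis
      using affine_hull_2_graph[of "x n" "x m" "y n" "y m"] less by (simp add: data_point_def n slope_def)
  qed
  have R: "affine hull {data_point x y (m + 1), data_point x y (m + 2)} =
      {(t, v). v = y m + slope x y m * h + slope x y (Suc m) * (t - x m - h)}"
    using affine_hull_2_graph[of "x (Suc m)" "x (Suc (Suc m))" "y (Suc m)" "y (Suc (Suc m))"] less
      slope_times_step[OF x, of m y] n by (simp add: data_point_def slope_def h_def)
  have "(slope x y (m - 1) * s = slope x y m * h + slope x y (Suc m) * (s - h)) \<longleftrightarrow> s = u" for s
  proof -
    have "(slope x y (m - 1) * s = slope x y m * h + slope x y (Suc m) * (s - h)) \<longleftrightarrow>
        (kink x y m + kink x y (Suc m)) * s = kink x y (Suc m) * h"
      by (auto simp: kink_def algebra_simps)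
    also have "\<dots> \<longleftrightarrow> s = u" using sum by (simp add: u_def h_def field_simps)
    finally show ?thesis .
  qed
  then have "t - x m = u \<and> v = y m + slope x y (m - 1) * u \<longleftrightarrow>
      v = y m + slope x y (m - 1) * (t - x m) \<and> v = y m + slope x y m * h + slope x y (Suc m) * (t - x m - h)" for t v
    by (metis add.assoc add_left_cancel)
  then have "p \<in> affine hull {data_point x y (m - 1), data_point x y m} \<inter>
      affine hull {data_point x y (m + 1), data_point x y (m + 2)} \<longleftrightarrow> p = (x m + u, y m + slope x y (m - 1) * u)" for p
    unfolding L R by (cases p) (auto simp: diff_eq_eq add.commute)
  then show ?thesis unfolding apex_def by simp
qed

text \<open>
  The three conditions place the point on the correct side of the chord and of the two extended segments.  The barycentric
  coefficients of the two data points are the slacks in the last two conditions, divided by the length of the interval.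
\<close>
lemma data_triangle_iff:
  assumes x: "strict_mono_on {1..M} x" and m: "m \<in> {2..M - 2}"
    and same_sign: "kink x y m * kink x y (Suc m) > 0"
  defines "w \<equiv> \<lambda>t v. y m + slope x y m * (t - x m) - v"
  shows "(t, v) \<in> data_triangle x y m \<longleftrightarrow>
    0 \<le> w t v / kink x y m \<and> w t v / kink x y m \<le> t - x m \<and> w t v / kink x y (Suc m) \<le> x (Suc m) - t"
proof -
  define a b h u where "a = kink x y m" and "b = kink x y (Suc m)" and "h = x (Suc m) - x m"
    and "u = b / (a + b) * h"
  have ab: "a \<noteq> 0" "b \<noteq> 0" "a + b \<noteq> 0" "b / (a + b) \<ge> 0" "a / (a + b) \<ge> 0"
    using same_sign by (auto simp: a_def b_def zero_less_mult_iff zero_le_divide_iff)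
  have h: "h > 0" using node_less[OF x, of m "Suc m"] m by (auto simp: h_def)
  have "1 \<le> m" "m < M" using m by auto
  then have y_Suc: "y (Suc m) = y m + slope x y m * h"
    using slope_times_step[OF x, of m y] by (simp add: h_def)
  have slope_pred: "slope x y (m - 1) = slope x y m - a" by (simp add: a_def kink_def)
  have apex: "apex x y m = (x m + u, y m + slope x y (m - 1) * u)"
    using apex_eq[OF x m, of y] ab by (simp add: u_def a_def b_def h_def)
  have tri: "(t, v) \<in> data_triangle x y m \<longleftrightarrow> (\<exists>\<alpha> \<beta> \<gamma>. 0 \<le> \<alpha> \<and> 0 \<le> \<beta> \<and> 0 \<le> \<gamma> \<and> \<alpha> + \<beta> + \<gamma> = 1 \<and>
      t - x m = \<beta> * u + \<gamma> * h \<and> w t v = \<beta> * (a * u))"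
  proof -
    have "t = \<alpha> * x m + \<beta> * (x m + u) + \<gamma> * x (Suc m) \<and>
        v = \<alpha> * y m + \<beta> * (y m + slope x y (m - 1) * u) + \<gamma> * y (Suc m) \<longleftrightarrow>
      t - x m = \<beta> * u + \<gamma> * h \<and> w t v = \<beta> * (a * u)" if "\<alpha> + \<beta> + \<gamma> = 1" for \<alpha> \<beta> \<gamma>
    proof -
      have \<alpha>: "\<alpha> = 1 - \<beta> - \<gamma>" using that by simp
      have "t = \<alpha> * x m + \<beta> * (x m + u) + \<gamma> * x (Suc m) \<longleftrightarrow> t - x m = \<beta> * u + \<gamma> * h"
        unfolding \<alpha> h_def by (auto simp: algebra_simps)
      moreover have "v = \<alpha> * y m + \<beta> * (y m + slope x y (m - 1) * u) + \<gamma> * y (Suc m) \<longleftrightarrow> w t v = \<beta> * (a * u)"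
        if "t - x m = \<beta> * u + \<gamma> * h"
        unfolding \<alpha> w_def that y_Suc slope_pred by (auto simp: algebra_simps)
      ultimately show ?thesis by blast
    qed
    then show ?thesis
      unfolding data_triangle_def apex convex_hull_3 by (auto simp: data_point_def) blast+
  qed
  show ?thesis
    unfolding tri a_def[symmetric] b_def[symmetric]
  proof (intro iffI; (elim exE conjE)?)
    fix \<alpha> \<beta> \<gamma> assume *: "0 \<le> \<alpha>" "0 \<le> \<beta>" "0 \<le> \<gamma>" "\<alpha> + \<beta> + \<gamma> = 1" "t - x m = \<beta> * u + \<gamma> * h" "w t v = \<beta> * (a * u)"
    have 1: "w t v / a = \<beta> * u" using *(6) ab by simp
    have 2: "w t v / b = \<beta> * (a / (a + b) * h)" using *(6) ab by (simp add: u_def)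
    have "b / (a + b) + a / (a + b) = 1" using ab by (simp add: add.commute flip: add_divide_distrib)
    then have "h = b / (a + b) * h + a / (a + b) * h" by (metis distrib_right mult_1)
    then have h_split: "h = u + a / (a + b) * h" by (simp add: u_def)
    have "x (Suc m) - t = h - (\<beta> * u + \<gamma> * h)" using *(5) by (simp add: h_def)
    also have "\<dots> = \<alpha> * h + \<beta> * (h - u)"
    proof -
      have \<alpha>: "\<alpha> = 1 - \<beta> - \<gamma>" using *(4) by simp
      show ?thesis unfolding \<alpha> by (simp add: algebra_simps)
    qed
    also have "h - u = a / (a + b) * h" using h_split by linarith
    finally have 3: "x (Suc m) - t = \<alpha> * h + \<beta> * (a / (a + b) * h)" .
    have "u \<ge> 0" unfolding u_def using ab h by (intro mult_nonneg_nonneg) auto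
    then show "0 \<le> w t v / a \<and> w t v / a \<le> t - x m \<and> w t v / b \<le> x (Suc m) - t"
      unfolding 1 2 3 *(5) using * h by simp
  next
    assume *: "0 \<le> w t v / a" "w t v / a \<le> t - x m" "w t v / b \<le> x (Suc m) - t"
    have wb: "w t v / b \<ge> 0"
      using * same_sign by (auto simp: a_def b_def zero_le_divide_iff zero_less_mult_iff)
    let ?\<alpha> = "(x (Suc m) - t - w t v / b) / h" and ?\<beta> = "(w t v / a + w t v / b) / h" and ?\<gamma> = "(t - x m - w t v / a) / h"
    have "?\<alpha> + ?\<beta> + ?\<gamma> = 1" using h by (simp add: h_def flip: add_divide_distrib)
    moreover have \<beta>u: "?\<beta> * u = w t v / a"
    proof -
      have "w t v / a + w t v / b = w t v * (a + b) / (a * b)" using ab by (simp add: field_simps)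
      then show ?thesis unfolding u_def using ab h by simp
    qed
    moreover have "w t v = ?\<beta> * (a * u)" using \<beta>u ab by (simp add: mult.left_commute[of _ a])
    moreover have "t - x m = ?\<beta> * u + ?\<gamma> * h" unfolding \<beta>u using h by simp
    moreover have "?\<alpha> \<ge> 0" "?\<beta> \<ge> 0" "?\<gamma> \<ge> 0" using * wb h by auto
    ultimately show "\<exists>\<alpha> \<beta> \<gamma>. 0 \<le> \<alpha> \<and> 0 \<le> \<beta> \<and> 0 \<le> \<gamma> \<and> \<alpha> + \<beta> + \<gamma> = 1 \<and>
      t - x m = \<beta> * u + \<gamma> * h \<and> w t v = \<beta> * (a * u)" by blast
  qed
qed

section \<open>The union of all solution graphs\<close>

lemma same_sign_indices_iff:
  "m \<in> same_sign_indices M x y \<longleftrightarrow> m \<in> {2..M - 2} \<and> kink x y m * kink x y (Suc m) > 0"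
  using cano_coeff_eq_kink[of m M x y] cano_coeff_eq_kink[of "Suc m" M x y]
  unfolding same_sign_indices_def by auto

lemma data_triangle_abscissa:
  assumes x: "strict_mono_on {1..M} x" and m: "m \<in> same_sign_indices M x y" and tri: "(t, v) \<in> data_triangle x y m"
  shows "x m \<le> t" "t \<le> x (Suc m)"
    and "t = x m \<Longrightarrow> v = y m" and "t = x (Suc m) \<Longrightarrow> v = y (Suc m)"
proof -
  have m': "m \<in> {2..M - 2}" and same_sign: "kink x y m * kink x y (Suc m) > 0"
    using m by (auto simp: same_sign_indices_iff)
  define w where "w = y m + slope x y m * (t - x m) - v"
  have *: "0 \<le> w / kink x y m" "w / kink x y m \<le> t - x m" "w / kink x y (Suc m) \<le> x (Suc m) - t"
    using tri data_triangle_iff[OF x m' same_sign, of t v] by (auto simp: w_def)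
  have **: "w / kink x y (Suc m) \<ge> 0"
    using *(1) same_sign by (auto simp: zero_le_divide_iff zero_less_mult_iff)
  show "x m \<le> t" "t \<le> x (Suc m)" using * ** by linarith+
  show "v = y m" if "t = x m" using * that same_sign by (auto simp: w_def)
  show "v = y (Suc m)" if "t = x (Suc m)"
  proof -
    have "w / kink x y (Suc m) = 0" using * ** that by linarith
    then have "w = 0" using same_sign by auto
    moreover have "1 \<le> m" "m < M" using m' by auto
    ultimately show ?thesis using slope_times_step[OF x, of m y] that by (simp add: w_def)
  qed
qed

text \<open>
  At a node all interpolants agree, and the triangles meet its vertical line in the data point at most.  Elsewhere \<open>(t, v)\<close> is inserted
  at the unique position \<open>k\<close> that keeps the nodes increasing; the only triangle over \<open>t\<close> can be the
  one with index \<open>k - 1\<close>.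
\<close>
lemma ex_solution_through:
  assumes x: "strict_mono_on {1..M} x" and "4 \<le> M"
  shows "(\<exists>f\<in>gBPC_solutions M x y. f t = v) \<longleftrightarrow>
    v = f_cano M x y t \<or> (\<exists>m\<in>same_sign_indices M x y. (t, v) \<in> data_triangle x y m)"
proof (cases "t \<in> x ` {1..M}")
  case True
  then obtain j where j: "j \<in> {1..M}" "t = x j" by blast
  have "v = y j" if m: "m \<in> same_sign_indices M x y" and tri: "(t, v) \<in> data_triangle x y m" for m
  proof -
    note abs = data_triangle_abscissa[OF x m tri]
    have "m \<in> {2..M - 2}" using m by (simp add: same_sign_indices_iff)
    then have "1 \<le> m" "m \<le> M" by auto
    then have "\<not> j < m" "\<not> Suc m < j"
      using node_less[OF x, of j m] node_less[OF x, of "Suc m" j] abs(1,2) j by auto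
    then have "j = m \<or> j = Suc m" by linarith
    then show ?thesis using abs(3,4) j(2) by blast
  qed
  moreover have "f_cano M x y \<in> gBPC_solutions M x y"
    using gBPC_solutions_iff[OF x, of "f_cano M x y" y] f_cano_feasible[OF x, of y] f_cano_BV2(2)[OF x, of y] \<open>4 \<le> M\<close> by simp
  moreover have "f t = y j" if "f \<in> gBPC_solutions M x y" for f
    using that j by (auto simp: gBPC_solutions_def gBPC_feasible_def)
  ultimately show ?thesis by metis
next
  case False
  \<comment> \<open>insertion position: the first node beyond \<open>t\<close>, or \<open>M + 1\<close> if there is none\<close>
  define k where "k = (LEAST k. 1 \<le> k \<and> (k = M + 1 \<or> t < x k))"
  have "1 \<le> k \<and> (k = M + 1 \<or> t < x k)" unfolding k_def by (rule LeastI[of _ "M + 1"]) simp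
  moreover have "k \<le> M + 1" unfolding k_def by (rule Least_le) simp
  ultimately have k: "k \<in> {1..M + 1}" and right: "k = M + 1 \<or> t < x k" by auto
  have left: "k = 1 \<or> x (k - 1) < t"
  proof (rule disjCI)
    assume "\<not> x (k - 1) < t"
    show "k = 1"
    proof (rule ccontr)
      assume "k \<noteq> 1"
      then have k': "k - 1 \<in> {1..M}" using k by auto
      then have "t \<noteq> x (k - 1)" using False by blast
      then have "k \<le> k - 1" unfolding k_def
        using k' \<open>\<not> x (k - 1) < t\<close> by (intro Least_le) (auto simp: k_def)
      then show False using k by (cases k) auto
    qed
  qed
  have through: "(\<exists>f\<in>gBPC_solutions M x y. f t = v) \<longleftrightarrow>
    (\<Sum>i\<in>{k - 1..k + 1} \<inter> {2..M}. \<bar>kink (insert_at k t x) (insert_at k v y) i\<bar>) \<le>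
    (\<Sum>i\<in>{k - 1..k} \<inter> {2..M - 1}. \<bar>kink x y i\<bar>)"
    using \<open>4 \<le> M\<close> by (intro ex_solution_through_iff[OF x _ k left right]) simp
  have tri: "(\<exists>m\<in>same_sign_indices M x y. (t, v) \<in> data_triangle x y m) \<longleftrightarrow>
    k - 1 \<in> same_sign_indices M x y \<and> (t, v) \<in> data_triangle x y (k - 1)"
  proof -
    have "m = k - 1" if m: "m \<in> same_sign_indices M x y" and tri: "(t, v) \<in> data_triangle x y m" for m
    proof -
      note abs = data_triangle_abscissa[OF x m tri]
      have "m \<in> {2..M - 2}" using m by (simp add: same_sign_indices_iff)
      then have m': "1 \<le> m" "Suc m \<le> M" by auto
      have "m < k"
      proof (rule ccontr)
        assume "\<not> m < k"
        then show False using node_le[OF x, of k m] right abs(1) m' k by auto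
      qed
      moreover have "k \<le> Suc m"
      proof (rule ccontr)
        assume "\<not> k \<le> Suc m"
        then have "Suc m \<le> k - 1" "k - 1 \<le> M" "k \<noteq> 1" using m' k by auto
        then show False using node_le[OF x, of "Suc m" "k - 1"] left abs(2) by auto
      qed
      ultimately show ?thesis by simp
    qed
    then show ?thesis by blast
  qed
  consider "k = 1" | "k = M + 1" | m where "k = Suc m" "1 \<le> m" "m < M"
    using k by (cases k) force+
  then show ?thesis
  proof cases
    case 1
    have "t < x 1" using 1 right \<open>4 \<le> M\<close> by simp
    have mid: "{k - 1..k + 1} \<inter> {2..M} = {2}" "{k - 1..k} \<inter> {2..M - 1} = {}" using 1 \<open>4 \<le> M\<close> by auto
    have "kink (insert_at k t x) (insert_at k v y) 2 = slope x y 1 - (y 1 - v) / (x 1 - t)"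
      using slope_insert_at(3)[of 1 t x v y] slope_insert_at(4)[of 1 1 t x v y]
      by (simp add: kink_def 1 numeral_2_eq_2)
    also have "\<dots> = 0 \<longleftrightarrow> v = y 1 + slope x y 1 * (t - x 1)"
      using \<open>t < x 1\<close> by (auto simp: field_simps)
    also have "y 1 + slope x y 1 * (t - x 1) = f_cano M x y t"
      using \<open>4 \<le> M\<close> \<open>t < x 1\<close> node_le[OF x, of 1 2]
      by (intro f_cano_on_piece[OF x, symmetric]) (auto simp: numeral_2_eq_2)
    finally show ?thesis
      unfolding through tri mid using 1 by (simp add: same_sign_indices_iff)
  next
    case 2
    define J where "J = M - 1"
    have J: "M = Suc J" "1 \<le> J" "J < M" using \<open>4 \<le> M\<close> by (auto simp: J_def)
    have "x M < t" using 2 left \<open>4 \<le> M\<close> by simp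
    have mid: "{k - 1..k + 1} \<inter> {2..M} = {M}" "{k - 1..k} \<inter> {2..M - 1} = {}" using 2 \<open>4 \<le> M\<close> by auto
    have "kink (insert_at k t x) (insert_at k v y) M = (v - y M) / (t - x M) - slope x y J"
      using slope_insert_at(2)[of "Suc M" t x v y] slope_insert_at(1)[of J "Suc M" t x v y]
      by (simp add: kink_def 2 J)
    also have "\<dots> = 0 \<longleftrightarrow> v = y M + slope x y J * (t - x M)"
      using \<open>x M < t\<close> by (auto simp: field_simps)
    also have "y M + slope x y J * (t - x M) = y J + slope x y J * (t - x J)"
      using slope_times_step[OF x J(2,3), of y] by (simp add: J(1) algebra_simps)
    also have "\<dots> = f_cano M x y t"
      using \<open>x M < t\<close> node_le[OF x, of J M] J by (intro f_cano_on_piece[OF x, symmetric]) auto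
    finally have "kink (insert_at k t x) (insert_at k v y) M = 0 \<longleftrightarrow> v = f_cano M x y t" .
    moreover have "k - 1 \<notin> same_sign_indices M x y"
      using 2 \<open>4 \<le> M\<close> by (auto simp: same_sign_indices_iff)
    ultimately show ?thesis
      unfolding through tri mid by simp
  next
    case (3 m)
    have t: "x m < t" "t < x (Suc m)" using 3 left right by auto
    define u r w where "u = t - x m" and "r = x (Suc m) - t" and "w = y m + slope x y m * (t - x m) - v"
    have pos: "u > 0" "r > 0" using t by (auto simp: u_def r_def)
    note kinks = kinks_insert_between[OF x 3(2,3) t, where y = y and v = v, folded u_def r_def w_def, folded 3(1)]
    have "f_cano M x y t = y m + slope x y m * (t - x m)"
      using t 3 by (intro f_cano_on_piece[OF x]) auto
    then have cano: "v = f_cano M x y t \<longleftrightarrow> w = 0" by (auto simp: w_def)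
    consider "m = 1" | "m = M - 1" | "m \<in> {2..M - 2}" using 3 by force
    then show ?thesis
    proof cases
      case m: 1
      have "{k - 1..k + 1} \<inter> {2..M} = {Suc m, Suc (Suc m)}" "{k - 1..k} \<inter> {2..M - 1} = {Suc m}"
        using m 3 \<open>4 \<le> M\<close> by auto
      then show ?thesis
        unfolding through tri cano using end_condition[OF pos, of w "kink x y (Suc m)"] kinks(2,3) 3 m
        by (simp add: same_sign_indices_iff)
    next
      case m: 2
      have "{k - 1..k + 1} \<inter> {2..M} = {m, Suc m}" "{k - 1..k} \<inter> {2..M - 1} = {m}"
        using m 3 \<open>4 \<le> M\<close> by auto
      then show ?thesis
        unfolding through tri cano using end_condition[OF pos(2,1), of w "kink x y m"] kinks(1,2) 3 m \<open>4 \<le> M\<close>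
        by (auto simp: same_sign_indices_iff add.commute)
    next
      case m: 3
      have mid: "{k - 1..k + 1} \<inter> {2..M} = {m, Suc m, Suc (Suc m)}" "{k - 1..k} \<inter> {2..M - 1} = {m, Suc m}"
        using m 3 \<open>4 \<le> M\<close> by auto
      have "(\<exists>f\<in>gBPC_solutions M x y. f t = v) \<longleftrightarrow> w = 0 \<or> (kink x y m * kink x y (Suc m) > 0 \<and>
          0 \<le> w / kink x y m \<and> w / kink x y m \<le> u \<and> w / kink x y (Suc m) \<le> r)"
        unfolding through mid mid_condition[OF pos, symmetric] using kinks m 3(1) by (simp add: add.assoc)
      then show ?thesis
        unfolding tri cano using 3(1) m data_triangle_iff[OF x m, where y = y and t = t and v = v]
        by (auto simp: same_sign_indices_iff u_def r_def w_def)
    qed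
  qed
qed

theorem theorem3:
  fixes M :: nat and x y :: "nat \<Rightarrow> real"
  assumes "4 \<le> M"
    and "strict_mono_on {1..M} x"
  shows "(\<Union>f\<in>gBPC_solutions M x y. graph f) =
         graph (f_cano M x y) \<union> (\<Union>m\<in>same_sign_indices M x y. data_triangle x y m)"
proof (rule set_eqI, rule prod.exhaust)
  fix p :: "real \<times> real" and t v assume "p = (t, v)"
  then show "p \<in> (\<Union>f\<in>gBPC_solutions M x y. graph f) \<longleftrightarrow>
      p \<in> graph (f_cano M x y) \<union> (\<Union>m\<in>same_sign_indices M x y. data_triangle x y m)"
    using ex_solution_through[OF assms(2,1), of y t v] by (auto simp: graph_def)
qed

end
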